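(* Let $\{T(t)\}_{t\ge0}$ be a $C_0$-semigroup (of scalar type spectral operators) on a complex Banach space generated by a scalar type spectral operator $A$. Then $$\sigma_p(T(t))=e^{t\sigma_p(A)},\quad t\ge0,$$ $$\sigma_r(T(t))=\emptyset,\quad t\ge0,$$ $$\sigma_c(T(t))=\overline{e^{t\sigma(A)}}\setminus e^{t\sigma_p(A)},\quad t\ge0.$$ If furthermore, for some $t>0$, the restriction of the exponential function $\lambda\mapsto e^{t\lambda}$ to $\sigma(A)$ is injective, then (for this $t$) $$\sigma_c(T(t))=e^{t\sigma_c(A)}\cup\left(\overline{e^{t\sigma(A)}}\setminus e^{t\sigma(A)}\right).$$ In particular (still under this injectivity), if the set $e^{t\sigma(A)}$ is closed, as is the case when the operator $A$ is bounded, then $$\sigma_c(T(t))=e^{t\sigma_c(A)}.$$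
   Context: Spectrum: for a closed linear operator $B$ in a complex Banach space $X$, the resolvent set $\rho(B)$ is the set of $\lambda\in\mathbb{C}$ for which $(B-\lambda I)^{-1}$ exists as a bounded linear operator on all of $X$, and $\sigma(B)=\mathbb{C}\setminus\rho(B)$. The point spectrum $\sigma_p(B)$ is the set of $\lambda$ with $B-\lambda I$ not injective; the continuous spectrum $\sigma_c(B)$ is the set of $\lambda$ with $B-\lambda I$ injective, not surjective, and with range dense in $X$; the residual spectrum $\sigma_r(B)$ is the set of $\lambda$ with $B-\lambda I$ injective and with range not dense in $X$. Scalar type spectral operator (Dunford, Bade): a densely defined closed linear operator $A$ in $X$ for which there is a (necessarily unique) strongly $\sigma$-additive spectral measure $E_A$ (the resolution of the identity), i.e. a map from the Borel sets of $\mathbb{C}$ to bounded projections on $X$ with $E_A(\emptyset)=0$, $E_A(\mathbb{C})=I$, $E_A(\delta_1\cap\delta_2)=E_A(\delta_1)E_A(\delta_2)$, and $\sigma$-additive in the strong operator topology, such that $A=\int_{\mathbb{C}}\lambda\,dE_A(\lambda)$; that is, the domain of $A$ consists of all $f\in X$ for which $\lim_{n\to\infty}\left(\int_{\{|\lambda|\le n\}}\lambda\,dE_A(\lambda)\right)f$ exists, and $Af$ is this limit (the integral of a bounded Borel function being the operator-norm limit of the integrals of uniformly approximating simple functions). The spectrum $\sigma(A)$ is the support of $E_A$. When such an $A$ generates a $C_0$-semigroup, all the operators $T(t)$ are themselves scalar type spectral, with $T(t)=\int_{\sigma(A)}e^{t\lambda}\,dE_A(\lambda)$, $t\ge0$.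 Notation: $e^{tS}=\{e^{t\lambda}:\lambda\in S\}$ for $S\subseteq\mathbb{C}$; the bar denotes closure in $\mathbb{C}$.
   Formalization: At t = 0 the formulas for σ_p(T(t)) and σ_c(T(t)) are stated only when σ_p(A) is non-empty; otherwise they fail on a nonzero space, e.g. for A = multiplication by x on L²[0,1], where T(0) = I has σ_p = {1} and σ_c = ∅. *)

theory Defs
  imports "HOL-Analysis.Analysis"
begin

text \<open>
  Complex Banach spaces: real Banach spaces with a compatible complex scalar multiplication
  for which the norm is absolutely homogeneous.
\<close>

class complex_banach = banach +
  fixes scaleC :: "complex \<Rightarrow> 'a \<Rightarrow> 'a" (infixr "*\<^sub>C" 75)
  assumes scaleC_add_right: "c *\<^sub>C (x + y) = c *\<^sub>C x + c *\<^sub>C y"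
    and scaleC_add_left: "(c + d) *\<^sub>C x = c *\<^sub>C x + d *\<^sub>C x"
    and scaleC_scaleC: "c *\<^sub>C d *\<^sub>C x = (c * d) *\<^sub>C x"
    and scaleC_of_real: "complex_of_real r *\<^sub>C x = r *\<^sub>R x"
    and norm_scaleC: "norm (c *\<^sub>C x) = cmod c * norm x"

definition bounded_clinear :: "('a::complex_banach \<Rightarrow> 'a) \<Rightarrow> bool" where
  "bounded_clinear B \<longleftrightarrow> bounded_linear B \<and> (\<forall>c x. B (c *\<^sub>C x) = c *\<^sub>C B x)"

text \<open>
  A possibly unbounded operator is given by its domain \<open>D\<close> and a function \<open>A\<close>, of which only
  the values on \<open>D\<close> matter. A bounded operator on the whole space has domain \<open>UNIV\<close>.
\<close>

definition linear_operator :: "'a::complex_banach set \<Rightarrow> ('a \<Rightarrow> 'a) \<Rightarrow> bool" where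
  "linear_operator D A \<longleftrightarrow>
     0 \<in> D \<and>
     (\<forall>x\<in>D. \<forall>y\<in>D. x + y \<in> D \<and> A (x + y) = A x + A y) \<and>
     (\<forall>c. \<forall>x\<in>D. c *\<^sub>C x \<in> D \<and> A (c *\<^sub>C x) = c *\<^sub>C A x)"

definition closed_operator :: "'a::complex_banach set \<Rightarrow> ('a \<Rightarrow> 'a) \<Rightarrow> bool" where
  "closed_operator D A \<longleftrightarrow> closed {(x, A x) | x. x \<in> D}"

definition densely_defined :: "'a::complex_banach set \<Rightarrow> bool" where
  "densely_defined D \<longleftrightarrow> closure D = UNIV"

definition bounded_operator :: "'a::complex_banach set \<Rightarrow> ('a \<Rightarrow> 'a) \<Rightarrow> bool" where
  "bounded_operator D A \<longleftrightarrow> (\<exists>K. \<forall>x\<in>D. norm (A x) \<le> K * norm x)"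

definition shifted :: "('a::complex_banach \<Rightarrow> 'a) \<Rightarrow> complex \<Rightarrow> 'a \<Rightarrow> 'a" where
  "shifted A \<mu> x = A x - \<mu> *\<^sub>C x"

definition resolvent_set :: "'a::complex_banach set \<Rightarrow> ('a \<Rightarrow> 'a) \<Rightarrow> complex set" where
  "resolvent_set D A =
     {\<mu>. bij_betw (shifted A \<mu>) D UNIV \<and> bounded_clinear (inv_into D (shifted A \<mu>))}"

definition spectrum :: "'a::complex_banach set \<Rightarrow> ('a \<Rightarrow> 'a) \<Rightarrow> complex set" where
  "spectrum D A = UNIV - resolvent_set D A"

definition point_spectrum :: "'a::complex_banach set \<Rightarrow> ('a \<Rightarrow> 'a) \<Rightarrow> complex set" where
  "point_spectrum D A = {\<mu>. \<not> inj_on (shifted A \<mu>) D}"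

definition continuous_spectrum :: "'a::complex_banach set \<Rightarrow> ('a \<Rightarrow> 'a) \<Rightarrow> complex set" where
  "continuous_spectrum D A =
     {\<mu>. inj_on (shifted A \<mu>) D \<and> shifted A \<mu> ` D \<noteq> UNIV \<and> closure (shifted A \<mu> ` D) = UNIV}"

definition residual_spectrum :: "'a::complex_banach set \<Rightarrow> ('a \<Rightarrow> 'a) \<Rightarrow> complex set" where
  "residual_spectrum D A =
     {\<mu>. inj_on (shifted A \<mu>) D \<and> closure (shifted A \<mu> ` D) \<noteq> UNIV}"

text \<open>
  Idempotence of \<open>E \<delta>\<close> is the multiplicativity law with both sets equal to \<open>\<delta>\<close>.
  The values of \<open>E\<close> outside the Borel sets are irrelevant.
\<close>

definition spectral_measure :: "(complex set \<Rightarrow> 'a::complex_banach \<Rightarrow> 'a) \<Rightarrow> bool" where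
  "spectral_measure E \<longleftrightarrow>
     (\<forall>\<delta>\<in>sets borel. bounded_clinear (E \<delta>)) \<and>
     E {} = (\<lambda>x. 0) \<and> E UNIV = id \<and>
     (\<forall>\<delta>\<^sub>1\<in>sets borel. \<forall>\<delta>\<^sub>2\<in>sets borel. E (\<delta>\<^sub>1 \<inter> \<delta>\<^sub>2) = E \<delta>\<^sub>1 \<circ> E \<delta>\<^sub>2) \<and>
     (\<forall>F :: nat \<Rightarrow> complex set. range F \<subseteq> sets borel \<longrightarrow> disjoint_family F \<longrightarrow>
        (\<forall>x. (\<lambda>n. E (F n) x) sums E (\<Union>n. F n) x))"

definition simple_spectral_integral ::
    "(complex set \<Rightarrow> 'a::complex_banach \<Rightarrow> 'a) \<Rightarrow> (complex \<Rightarrow> complex) \<Rightarrow> 'a \<Rightarrow> 'a" where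
  "simple_spectral_integral E s x = (\<Sum>c\<in>range s. c *\<^sub>C E (s -` {c}) x)"

definition has_spectral_integral ::
    "(complex set \<Rightarrow> 'a::complex_banach \<Rightarrow> 'a) \<Rightarrow> (complex \<Rightarrow> complex) \<Rightarrow> ('a \<Rightarrow> 'a) \<Rightarrow> bool" where
  "has_spectral_integral E g B \<longleftrightarrow>
     bounded_clinear B \<and>
     (\<exists>s. (\<forall>n. simple_function borel (s n)) \<and> uniform_limit UNIV s g sequentially \<and>
          (\<lambda>n. onorm (\<lambda>x. simple_spectral_integral E (s n) x - B x)) \<longlonglongrightarrow> 0)"

text \<open>
  For a spectral measure \<open>E\<close> and a bounded Borel function \<open>g\<close>, the limit operator exists and does
  not depend on the approximating simple functions.
\<close>

definition spectral_integral ::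
    "(complex set \<Rightarrow> 'a::complex_banach \<Rightarrow> 'a) \<Rightarrow> (complex \<Rightarrow> complex) \<Rightarrow> 'a \<Rightarrow> 'a" where
  "spectral_integral E g = (THE B. has_spectral_integral E g B)"

definition truncated_identity :: "nat \<Rightarrow> complex \<Rightarrow> complex" where
  "truncated_identity n z = (if cmod z \<le> real n then z else 0)"

definition resolution_of_identity ::
    "(complex set \<Rightarrow> 'a::complex_banach \<Rightarrow> 'a) \<Rightarrow> 'a set \<Rightarrow> ('a \<Rightarrow> 'a) \<Rightarrow> bool" where
  "resolution_of_identity E D A \<longleftrightarrow>
     spectral_measure E \<and>
     D = {x. convergent (\<lambda>n. spectral_integral E (truncated_identity n) x)} \<and>
     (\<forall>x\<in>D. (\<lambda>n. spectral_integral E (truncated_identity n) x) \<longlonglongrightarrow> A x)"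

definition scalar_type_spectral :: "'a::complex_banach set \<Rightarrow> ('a \<Rightarrow> 'a) \<Rightarrow> bool" where
  "scalar_type_spectral D A \<longleftrightarrow>
     linear_operator D A \<and> densely_defined D \<and> closed_operator D A \<and>
     (\<exists>E. resolution_of_identity E D A)"

text \<open>Only the values \<open>T t\<close> for \<open>t \<ge> 0\<close> matter.\<close>

definition C0_semigroup :: "(real \<Rightarrow> 'a::complex_banach \<Rightarrow> 'a) \<Rightarrow> bool" where
  "C0_semigroup T \<longleftrightarrow>
     (\<forall>t\<ge>0. bounded_clinear (T t)) \<and>
     T 0 = id \<and>
     (\<forall>s\<ge>0. \<forall>t\<ge>0. T (s + t) = T s \<circ> T t) \<and>
     (\<forall>x. ((\<lambda>t. T t x) \<longlongrightarrow> x) (at_right 0))"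

definition generates :: "'a::complex_banach set \<Rightarrow> ('a \<Rightarrow> 'a) \<Rightarrow> (real \<Rightarrow> 'a \<Rightarrow> 'a) \<Rightarrow> bool" where
  "generates D A T \<longleftrightarrow>
     D = {x. \<exists>y. ((\<lambda>h. (T h x - x) /\<^sub>R h) \<longlongrightarrow> y) (at_right 0)} \<and>
     (\<forall>x\<in>D. ((\<lambda>h. (T h x - x) /\<^sub>R h) \<longlongrightarrow> A x) (at_right 0))"

definition exp_image :: "real \<Rightarrow> complex set \<Rightarrow> complex set" where
  "exp_image t S = (\<lambda>z. exp (of_real t * z)) ` S"

end

theory Submission
  imports Defs
begin

text \<open>
  Both \<open>A\<close> and \<open>T t\<close> are functions of the spectral measure \<open>E\<close>: on the range of \<open>E \<delta>\<close>,
  \<open>\<delta>\<close> bounded, they act as the bounded spectral integrals of \<open>z\<close> and \<open>exp (t * z)\<close>. For \<open>T t\<close> this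
  holds because \<open>A\<close> is bounded on such a range and the semigroup solves the linear differential
  equation of \<open>A\<close>.

  Let \<open>B\<close> be any operator which is a continuous function \<open>f\<close> of \<open>E\<close> in this sense. The spectral
  integral of \<open>1\<^bsub>\<delta>\<^esub> / (f - \<mu>)\<close> inverts \<open>B - \<mu>\<close> on the range of \<open>E \<delta>\<close> if \<open>f\<close> stays away from \<open>\<mu>\<close> on \<open>\<delta>\<close>.
  So \<open>\<mu>\<close> is an eigenvalue iff \<open>E {f = \<mu>} \<noteq> 0\<close>, it is in the resolvent set iff
  \<open>E {\<bar>f - \<mu>\<bar> < e} = 0\<close> for some \<open>e > 0\<close>, and in the remaining case the range of \<open>B - \<mu>\<close> is dense and,
  by uniform boundedness of these partial inverses, proper. The spectral identities then reduce to
  two facts about \<open>exp\<close>: it is continuous, and for \<open>t > 0\<close> the set \<open>{z. exp (t * z) = \<mu>}\<close> is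
  countable, so \<open>E\<close> charges it iff it charges one of its points.
\<close>

section \<open>Bounded linear operators and vector measures\<close>

lemma scaleC_zero_left [simp]: "0 *\<^sub>C x = 0"
  using scaleC_of_real[of 0 x] by simp

lemma scaleC_one [simp]: "1 *\<^sub>C x = x"
  using scaleC_of_real[of 1 x] by simp

lemma bounded_linear_scaleC: "bounded_linear (\<lambda>x. c *\<^sub>C x)"
proof
  show "c *\<^sub>C r *\<^sub>R x = r *\<^sub>R c *\<^sub>C x" for r x
    by (simp flip: scaleC_of_real add: scaleC_scaleC mult.commute)
  show "\<exists>K. \<forall>x. norm (c *\<^sub>C x) \<le> norm x * K"
    by (intro exI[of _ "cmod c"]) (simp add: norm_scaleC mult.commute)
qed (simp add: scaleC_add_right)

lemmas scaleC_zero_right [simp] = linear_0[OF bounded_linear.linear[OF bounded_linear_scaleC]]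
  and scaleC_diff_right = linear_diff[OF bounded_linear.linear[OF bounded_linear_scaleC]]
  and scaleC_sum_right = linear_sum[OF bounded_linear.linear[OF bounded_linear_scaleC]]
  and tendsto_scaleC = bounded_linear.tendsto[OF bounded_linear_scaleC]

lemma scaleC_diff_left: "(c - d) *\<^sub>C x = c *\<^sub>C x - d *\<^sub>C x"
  by (metis add_diff_cancel diff_add_cancel scaleC_add_left)

lemma bounded_clinear_scaleC: "bounded_clinear B \<Longrightarrow> bounded_clinear (\<lambda>x. c *\<^sub>C B x)"
  unfolding bounded_clinear_def
  by (auto intro: bounded_linear_compose[OF bounded_linear_scaleC] simp: scaleC_scaleC mult.commute)

lemma bounded_clinear_sum:
  "(\<And>i. i \<in> I \<Longrightarrow> bounded_clinear (B i)) \<Longrightarrow> bounded_clinear (\<lambda>x. \<Sum>i\<in>I. B i x)"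
  unfolding bounded_clinear_def by (auto intro: bounded_linear_sum simp: scaleC_sum_right)

context
  fixes B :: "'a::complex_banach \<Rightarrow> 'a" assumes B: "bounded_clinear B"
begin

lemma bounded_clinear_bounded_linear: "bounded_linear B"
  using B by (simp add: bounded_clinear_def)

lemma bounded_clinear_scaleC_eq: "B (c *\<^sub>C x) = c *\<^sub>C B x"
  using B by (simp add: bounded_clinear_def)

lemmas bounded_clinear_0 = linear_0[OF bounded_linear.linear[OF bounded_clinear_bounded_linear]]
  and bounded_clinear_add_eq = linear_add[OF bounded_linear.linear[OF bounded_clinear_bounded_linear]]
  and bounded_clinear_diff_eq = linear_diff[OF bounded_linear.linear[OF bounded_clinear_bounded_linear]]
  and bounded_clinear_sum_eq = linear_sum[OF bounded_linear.linear[OF bounded_clinear_bounded_linear]]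
  and bounded_clinear_scaleR_eq = linear_cmul[OF bounded_linear.linear[OF bounded_clinear_bounded_linear]]
  and bounded_clinear_tendsto = bounded_linear.tendsto[OF bounded_clinear_bounded_linear]

end

text \<open>By Baire, one of the closed sets \<open>V n\<close>, which together cover the space, has
  interior; a ball inside it gives a bound common to all operators. This is used for the measure
  \<open>E\<close>, for the semigroup near zero and for the partial inverses of a shifted
  operator.\<close>

lemma uniform_boundedness:
  fixes f :: "'i \<Rightarrow> 'a::banach \<Rightarrow> 'b::real_normed_vector"
  assumes lin: "\<And>i. i \<in> I \<Longrightarrow> bounded_linear (f i)"
    and bdd: "\<And>x. \<exists>C. \<forall>i\<in>I. norm (f i x) \<le> C"
  shows "\<exists>K\<ge>0. \<forall>i\<in>I. \<forall>x. norm (f i x) \<le> K * norm x"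
proof -
  define V where "V n = {x. \<forall>i\<in>I. norm (f i x) \<le> real n}" for n
  have V: "closed (V n)" for n
  proof -
    have "V n = (\<Inter>i\<in>I. {x. norm (f i x) \<le> real n})"
      by (auto simp: V_def)
    moreover have "closed {x. norm (f i x) \<le> real n}" if "i \<in> I" for i
      by (intro closed_Collect_le continuous_intros linear_continuous_on lin that)
    ultimately show ?thesis by auto
  qed
  have "\<Union>(range V) = UNIV"
  proof -
    have "\<exists>n. x \<in> V n" for x
    proof -
      obtain C n where "\<forall>i\<in>I. norm (f i x) \<le> C" "C \<le> real n"
        using bdd[of x] real_arch_simple by blast
      then have "x \<in> V n" by (auto simp: V_def intro: order_trans)
      then show ?thesis ..
    qed
    then show ?thesis by auto
  qed
  then have "interior (\<Union>(range V)) \<noteq> {}" by simp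
  then obtain n where "interior (V n) \<noteq> {}"
    using Met_TC.metric_Baire_category_alt[where 'a = 'a, of "range V"] V
    by (auto simp: complete_UNIV)
  then obtain a e where e: "e > 0" and ball: "cball a e \<subseteq> V n"
    by (meson all_not_in_conv mem_interior_cball)
  show ?thesis
  proof (intro exI[of _ "2 * real n / e"] conjI ballI allI)
    fix i x assume i: "i \<in> I"
    interpret bounded_linear "f i" using lin[OF i] .
    show "norm (f i x) \<le> 2 * real n / e * norm x"
    proof (cases "x = 0")
      case False
      \<comment> \<open>\<open>y\<close> is \<open>x\<close> rescaled to the radius of the ball, so
        that \<open>f i y\<close> is the difference of the values at \<open>a + y\<close> and
        \<open>a\<close>, both in \<open>V n\<close>. This gives the 2 in the constant.\<close>
      define y where "y = (e / norm x) *\<^sub>R x"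
      have "norm y = e" using False e by (simp add: y_def)
      then have "a + y \<in> V n" "a \<in> V n" using ball e by (auto simp: dist_norm subset_iff)
      then have "norm (f i (a + y)) \<le> n" "norm (f i a) \<le> n" using i by (auto simp: V_def)
      moreover have "norm (f i y) \<le> norm (f i (a + y)) + norm (f i a)"
        using norm_triangle_ineq4[of "f i (a + y)" "f i a"] by (simp add: add)
      ultimately have "norm (f i y) \<le> 2 * n" by linarith
      then show ?thesis using False e by (simp add: y_def scaleR field_simps)
    qed (simp add: zero)
  qed (use e in auto)
qed

text \<open>The norm is convex, and a point of the unit cube of coefficients is a convex combination
  of its vertices, whose sums are the subset sums. The induction moves one coordinate at a time to 0
  or 1; the offset \<open>w\<close> collects the terms whose coefficient has become 1.\<close>

lemma norm_sum_scaleR_unit_le: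
  fixes v :: "'i \<Rightarrow> 'a::real_normed_vector"
  assumes "finite I" "\<And>J. J \<subseteq> I \<Longrightarrow> norm (w + sum v J) \<le> M" "\<And>i. i \<in> I \<Longrightarrow> 0 \<le> a i \<and> a i \<le> (1::real)"
  shows "norm (w + (\<Sum>i\<in>I. a i *\<^sub>R v i)) \<le> M"
  using assms
proof (induction I arbitrary: w)
  case empty
  then show ?case by force
next
  case (insert k I)
  let ?s = "\<Sum>i\<in>I. a i *\<^sub>R v i"
  have 1: "norm (w + ?s) \<le> M"
    by (rule insert.IH) (use insert.prems in auto)
  have 2: "norm ((w + v k) + ?s) \<le> M"
  proof (rule insert.IH)
    fix J assume J: "J \<subseteq> I"
    then have "k \<notin> J" "finite J" using insert.hyps finite_subset by auto
    then show "norm (w + v k + sum v J) \<le> M"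
      using insert.prems(1)[of "insert k J"] J by (auto simp: add.assoc)
  qed (use insert.prems in auto)
  have a: "0 \<le> a k" "a k \<le> 1" using insert.prems(2) by auto
  have "w + (\<Sum>i\<in>insert k I. a i *\<^sub>R v i) = (1 - a k) *\<^sub>R (w + ?s) + a k *\<^sub>R (w + v k + ?s)"
    using insert.hyps by (simp add: algebra_simps)
  also have "norm \<dots> \<le> (1 - a k) * norm (w + ?s) + a k * norm (w + v k + ?s)"
    using norm_triangle_ineq[of "(1 - a k) *\<^sub>R (w + ?s)" "a k *\<^sub>R (w + v k + ?s)"] a by simp
  also have "\<dots> \<le> (1 - a k) * M + a k * M"
    by (intro add_mono mult_left_mono 1 2) (use a in auto)
  finally show ?case by (simp add: algebra_simps)
qed

text \<open>After division by \<open>c\<close>, the positive and negative parts of the coefficients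
  lie in the unit interval; each part contributes \<open>c * M\<close>.\<close>

lemma norm_sum_scaleR_le:
  fixes v :: "'i \<Rightarrow> 'a::real_normed_vector"
  assumes I: "finite I" and M: "\<And>J. J \<subseteq> I \<Longrightarrow> norm (sum v J) \<le> M"
    and a: "\<And>i. i \<in> I \<Longrightarrow> \<bar>a i\<bar> \<le> c" and c: "c > 0"
  shows "norm (\<Sum>i\<in>I. a i *\<^sub>R v i) \<le> 2 * c * M"
proof -
  define p where "p i = max (a i) 0 / c" for i
  define q where "q i = max (- a i) 0 / c" for i
  have "(\<Sum>i\<in>I. a i *\<^sub>R v i) = (\<Sum>i\<in>I. c *\<^sub>R (p i *\<^sub>R v i) - c *\<^sub>R (q i *\<^sub>R v i))"
    using c by (intro sum.cong) (auto simp: p_def q_def max_def simp flip: scaleR_diff_left)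
  also have "\<dots> = c *\<^sub>R ((\<Sum>i\<in>I. p i *\<^sub>R v i) - (\<Sum>i\<in>I. q i *\<^sub>R v i))"
    by (simp add: sum_subtractf scaleR_diff_right scaleR_sum_right)
  also have "norm \<dots> \<le> c * (norm (\<Sum>i\<in>I. p i *\<^sub>R v i) + norm (\<Sum>i\<in>I. q i *\<^sub>R v i))"
    using c norm_triangle_ineq4 by simp
  also have "\<dots> \<le> c * (M + M)"
  proof (intro mult_left_mono add_mono)
    have *: "0 \<le> p i \<and> p i \<le> 1" "0 \<le> q i \<and> q i \<le> 1" if "i \<in> I" for i
      using a[OF that] c by (auto simp: p_def q_def divide_simps)
    show "norm (\<Sum>i\<in>I. p i *\<^sub>R v i) \<le> M" "norm (\<Sum>i\<in>I. q i *\<^sub>R v i) \<le> M"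
      using norm_sum_scaleR_unit_le[of I 0 v M p] norm_sum_scaleR_unit_le[of I 0 v M q] I M * by auto
  qed (use c in auto)
  finally show ?thesis by (simp add: algebra_simps)
qed

text \<open>Real and imaginary parts are treated separately, which doubles the real constant. This
  is where the factor 4 of all later integral estimates comes from.\<close>

lemma norm_sum_scaleC_le:
  fixes v :: "'i \<Rightarrow> 'a::complex_banach"
  assumes I: "finite I" and M: "\<And>J. J \<subseteq> I \<Longrightarrow> norm (sum v J) \<le> M"
    and a: "\<And>i. i \<in> I \<Longrightarrow> cmod (a i) \<le> c" and c: "c > 0"
  shows "norm (\<Sum>i\<in>I. a i *\<^sub>C v i) \<le> 4 * c * M"
proof -
  have "a i *\<^sub>C v i = Re (a i) *\<^sub>R v i + \<i> *\<^sub>C (Im (a i) *\<^sub>R v i)" for i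
    by (simp add: scaleC_scaleC flip: scaleC_of_real scaleC_add_left complex_eq)
  then have "(\<Sum>i\<in>I. a i *\<^sub>C v i)
      = (\<Sum>i\<in>I. Re (a i) *\<^sub>R v i) + \<i> *\<^sub>C (\<Sum>i\<in>I. Im (a i) *\<^sub>R v i)"
    by (simp add: sum.distrib scaleC_sum_right)
  also have "norm \<dots> \<le> norm (\<Sum>i\<in>I. Re (a i) *\<^sub>R v i) + norm (\<Sum>i\<in>I. Im (a i) *\<^sub>R v i)"
    using norm_triangle_ineq[of _ "\<i> *\<^sub>C _"] by (simp add: norm_scaleC)
  also have "\<dots> \<le> 2 * c * M + 2 * c * M"
    by (intro add_mono norm_sum_scaleR_le I M c)
       (use a abs_Re_le_cmod abs_Im_le_cmod order_trans in blast)+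
  finally show ?thesis by (simp add: algebra_simps)
qed

text \<open>If \<open>m\<close> is unbounded on a set \<open>A\<close>, a subset \<open>B\<close> of large norm splits \<open>A\<close> into two pieces of
  norm at least one, and \<open>m\<close> stays unbounded on one of them. Iterating produces infinitely many disjoint
  pieces of norm at least one.\<close>

lemma vector_measure_bounded:
  fixes m :: "'s set \<Rightarrow> 'a::real_normed_vector"
  assumes alg: "sigma_algebra UNIV S"
    and sums: "\<And>F :: nat \<Rightarrow> 's set. range F \<subseteq> S \<Longrightarrow> disjoint_family F \<Longrightarrow> summable (\<lambda>n. m (F n))"
    and additive: "\<And>A B. A \<in> S \<Longrightarrow> B \<in> S \<Longrightarrow> A \<inter> B = {} \<Longrightarrow> m (A \<union> B) = m A + m B"
  shows "\<exists>C. \<forall>A\<in>S. norm (m A) \<le> C"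
proof (rule ccontr)
  interpret sigma_algebra UNIV S by (fact alg)
  define unb where "unb A \<longleftrightarrow> A \<in> S \<and> (\<forall>C. \<exists>B\<in>S. B \<subseteq> A \<and> norm (m B) > C)" for A
  assume "\<not> ?thesis"
  then have U: "unb UNIV" by (auto simp: unb_def not_le)
  have step: "\<exists>B. unb B \<and> B \<subseteq> A \<and> norm (m (A - B)) \<ge> 1" if A: "unb A" for A
  proof -
    have AS: "A \<in> S" using A by (simp add: unb_def)
    \<comment> \<open>The threshold makes both pieces large: \<open>A - B\<close> has norm at least
      the difference of the norms of \<open>m B\<close> and \<open>m A\<close>, hence more than
      1.\<close>
    obtain B where B: "B \<in> S" "B \<subseteq> A" "norm (m B) > 1 + norm (m A)"
      using A by (auto simp: unb_def)
    have mA: "m A = m B + m (A - B)"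
      using additive[of B "A - B"] B AS by (auto simp: Un_absorb1)
    have "norm (m B) - norm (m A) \<le> norm (m (A - B))"
      using norm_triangle_ineq2[of "m B" "m A"] by (simp add: mA)
    then have n: "norm (m (A - B)) \<ge> 1" "norm (m B) \<ge> 1"
      using B(3) norm_ge_zero[of "m A"] by linarith+
    show ?thesis
    proof (cases "unb B")
      case True
      then show ?thesis using n B by auto
    next
      case False
      then obtain C where C: "\<And>Q. Q \<in> S \<Longrightarrow> Q \<subseteq> B \<Longrightarrow> norm (m Q) \<le> C"
        using B(1) by (auto simp: unb_def not_less)
      \<comment> \<open>Subsets of \<open>B\<close> contribute at most \<open>C\<close>, so a set
        \<open>Q\<close> of norm above \<open>C + D\<close> keeps norm above \<open>D\<close>
        outside \<open>B\<close>.\<close>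
      have "unb (A - B)" unfolding unb_def
      proof (intro conjI allI)
        fix D
        obtain Q where Q: "Q \<in> S" "Q \<subseteq> A" "norm (m Q) > C + D"
          using A by (auto simp: unb_def)
        have "m Q = m (Q \<inter> B) + m (Q - B)"
          using additive[of "Q \<inter> B" "Q - B"] Q B by (auto simp: Int_Diff_Un Un_Diff_Int)
        then have "norm (m Q) \<le> norm (m (Q \<inter> B)) + norm (m (Q - B))"
          by (simp add: norm_triangle_ineq)
        moreover have "norm (m (Q \<inter> B)) \<le> C" using C Q B by auto
        ultimately have "norm (m (Q - B)) > D"
          using Q(3) by linarith
        then show "\<exists>R\<in>S. R \<subseteq> A - B \<and> norm (m R) > D" using Q B by (intro bexI[of _ "Q - B"]) auto
      qed (use AS B in auto)
      moreover have "A - (A - B) = B" using B by auto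
      ultimately show ?thesis using n by (intro exI[of _ "A - B"]) auto
    qed
  qed
  obtain A where "\<forall>n. unb (A n) \<and> (A (Suc n) \<subseteq> A n \<and> norm (m (A n - A (Suc n))) \<ge> 1)"
  proof (rule exE[OF dependent_nat_choice[of "\<lambda>_. unb" "\<lambda>_ A B. B \<subseteq> A \<and> norm (m (A - B)) \<ge> 1"]])
    show "\<exists>x. unb x" using U by blast
    show "\<exists>B. unb B \<and> B \<subseteq> A \<and> norm (m (A - B)) \<ge> 1" if "unb A" for A and n :: nat
      using step[OF that] .
  qed
  then have A: "unb (A n)" "A (Suc n) \<subseteq> A n \<and> norm (m (A n - A (Suc n))) \<ge> 1" for n
    by auto
  have dec: "A j \<subseteq> A i" if "i \<le> j" for i j
    using that A(2) lift_Suc_antimono_le[of A i j] by auto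
  define F where "F n = A n - A (Suc n)" for n
  have "F i \<inter> F j = {}" if "i < j" for i j
    using dec[of "Suc i" j] that by (auto simp: F_def)
  then have "disjoint_family F"
    by (auto simp: disjoint_family_on_def) (metis IntI empty_iff nat_neq_iff)
  moreover have "range F \<subseteq> S" using A(1) by (auto simp: F_def unb_def)
  ultimately have "(\<lambda>n. m (F n)) \<longlonglongrightarrow> 0" using sums summable_LIMSEQ_zero by blast
  then have "\<forall>\<^sub>F n in sequentially. norm (m (F n)) < 1"
    using order_tendstoD(2)[OF tendsto_norm_zero] by fastforce
  then obtain n where "norm (m (F n)) < 1"
    by (auto simp: eventually_sequentially)
  then show False using A(2)[of n] by (simp add: F_def)
qed

section \<open>Bounded spectral integrals\<close>

locale spectral_resolution =
  fixes E :: "complex set \<Rightarrow> 'a::complex_banach \<Rightarrow> 'a"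
  assumes spectral: "spectral_measure E"
begin

lemma E_clinear: "\<delta> \<in> sets borel \<Longrightarrow> bounded_clinear (E \<delta>)"
  using spectral by (auto simp: spectral_measure_def)

lemma E_empty [simp]: "E {} x = 0"
  using spectral by (auto simp: spectral_measure_def)

lemma E_UNIV [simp]: "E UNIV x = x"
  using spectral by (auto simp: spectral_measure_def)

lemma E_Int: "A \<in> sets borel \<Longrightarrow> B \<in> sets borel \<Longrightarrow> E (A \<inter> B) x = E A (E B x)"
  using spectral by (auto simp: spectral_measure_def)

lemma E_sums:
  "range F \<subseteq> sets borel \<Longrightarrow> disjoint_family F \<Longrightarrow> (\<lambda>n::nat. E (F n) x) sums E (\<Union>n. F n) x"
  using spectral unfolding spectral_measure_def by blast

text \<open>Finite additivity is countable additivity for the sequence \<open>A\<close>,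
  \<open>B\<close>, followed by empty sets.\<close>

lemma E_Un:
  assumes "A \<in> sets borel" "B \<in> sets borel" "A \<inter> B = {}"
  shows "E (A \<union> B) x = E A x + E B x"
proof -
  have "range (binaryset A B) \<subseteq> sets borel"
    using assms by (auto simp: range_binaryset_eq)
  moreover have "disjoint_family (binaryset A B)"
    using assms by (auto simp: disjoint_family_on_def binaryset_def)
  ultimately have "(\<lambda>n. E (binaryset A B n) x) sums E (A \<union> B) x"
    using E_sums[of "binaryset A B" x] by (simp add: UN_binaryset_eq)
  moreover have "(\<lambda>n. E (binaryset A B n) x) sums (E A x + E B x)"
    using binaryset_sums[of "\<lambda>A. E A x"] by simp
  ultimately show ?thesis by (rule sums_unique2)
qed

lemma E_UN_finite:
  assumes "finite I" "\<And>i. i \<in> I \<Longrightarrow> F i \<in> sets borel" "disjoint_family_on F I"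
  shows "E (\<Union>i\<in>I. F i) x = (\<Sum>i\<in>I. E (F i) x)"
  using assms
proof (induction I)
  case (insert i I)
  have "F i \<inter> (\<Union>j\<in>I. F j) = {}"
    using insert by (auto simp: disjoint_family_on_def)
  then show ?case
    using insert E_Un[of "F i" "\<Union>j\<in>I. F j"] sets.finite_UN[of I F borel]
    by (auto simp: disjoint_family_on_def)
qed auto

lemma E_incseq:
  assumes F: "\<And>n::nat. F n \<in> sets borel" "incseq F"
  shows "(\<lambda>n. E (F n) x) \<longlonglongrightarrow> E (\<Union>n. F n) x"
proof -
  let ?D = "disjointed F"
  have D: "range ?D \<subseteq> sets borel"
    using F by (intro sets.range_disjointed_sets) auto
  have "(\<lambda>n. E (?D n) x) sums E (\<Union>n. F n) x"
    using E_sums[OF D disjoint_family_disjointed] by (simp add: UN_disjointed_eq)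
  \<comment> \<open>The index is shifted because \<open>F n\<close> is the union of the first
    \<open>Suc n\<close> disjoint pieces.\<close>
  then have "(\<lambda>n. \<Sum>i<Suc n. E (?D i) x) \<longlonglongrightarrow> E (\<Union>n. F n) x"
    unfolding sums_def by (rule LIMSEQ_Suc)
  moreover have "(\<Sum>i<Suc n. E (?D i) x) = E (F n) x" for n
  proof -
    have "(\<Sum>i<Suc n. E (?D i) x) = E (\<Union>i\<in>{..<Suc n}. ?D i) x"
      using D disjoint_family_disjointed[of F]
      by (intro E_UN_finite[symmetric]) (auto simp: disjoint_family_on_def)
    also have "(\<Union>i\<in>{..<Suc n}. ?D i) = (\<Union>i\<in>{..<Suc n}. F i)"
      using finite_UN_disjointed_eq[of F "Suc n"] by (simp add: lessThan_atLeast0)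
    also have "\<dots> = F n" using \<open>incseq F\<close> by (auto simp: incseq_def less_Suc_eq_le subset_iff)
    finally show ?thesis .
  qed
  ultimately show ?thesis by simp
qed

text \<open>For a general vector measure a set of measure zero may have subsets of nonzero measure.
  Here multiplicativity excludes this: \<open>E A x = E A (E B x)\<close> for
  \<open>A \<subseteq> B\<close>.\<close>

lemma E_subset_zero:
  assumes "A \<in> sets borel" "B \<in> sets borel" "A \<subseteq> B" "E B x = 0"
  shows "E A x = 0"
  using E_Int[OF assms(1,2), of x] assms bounded_clinear_0[OF E_clinear[OF assms(1)]]
  by (simp add: Int_absorb2)

lemma E_countable_zero:
  assumes "\<And>n::nat. F n \<in> sets borel" "\<And>n. E (F n) x = 0"
  shows "E (\<Union>n. F n) x = 0"
proof -
  let ?D = "disjointed F"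
  have D: "range ?D \<subseteq> sets borel"
    using assms by (intro sets.range_disjointed_sets) auto
  have "E (?D n) x = 0" for n
    using D assms disjointed_subset[of F n] by (intro E_subset_zero[of "?D n" "F n"]) auto
  then show ?thesis
    using E_sums[OF D disjoint_family_disjointed, of x] by (simp add: UN_disjointed_eq sums_iff)
qed

text \<open>Boundedness is obtained twice: for fixed \<open>x\<close> over all Borel sets, because
  \<open>E\<close> applied to \<open>x\<close> is a countably additive vector measure, and then
  uniformly in \<open>x\<close> by uniform boundedness. The strictly positive constant can be
  divided by later.\<close>

lemma E_bounded_ex: "\<exists>M>0. \<forall>\<delta>\<in>sets borel. \<forall>x. norm (E \<delta> x) \<le> M * norm x"
proof -
  have "\<exists>C. \<forall>A\<in>sets borel. norm (E A x) \<le> C" for x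
  proof (rule vector_measure_bounded)
    show "sigma_algebra UNIV (sets (borel :: complex measure))"
      using sets.sigma_algebra_axioms[of "borel :: complex measure"] by simp
  qed (auto simp: E_Un dest: E_sums[THEN sums_summable])
  then obtain K where "K \<ge> 0" "\<And>\<delta> x. \<delta> \<in> sets borel \<Longrightarrow> norm (E \<delta> x) \<le> K * norm x"
    using uniform_boundedness[of "sets borel" E] E_clinear bounded_clinear_bounded_linear by blast
  then show ?thesis
    by (intro exI[of _ "K + 1"]) (auto simp: distrib_right intro: order_trans add_increasing2)
qed

definition bound :: real where
  "bound = (SOME M. M > 0 \<and> (\<forall>\<delta>\<in>sets borel. \<forall>x. norm (E \<delta> x) \<le> M * norm x))"

lemma bound_pos: "bound > 0" and E_bound: "\<delta> \<in> sets borel \<Longrightarrow> norm (E \<delta> x) \<le> bound * norm x"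
  using someI_ex[OF E_bounded_ex] by (simp_all add: bound_def)

section \<open>Integrals of simple functions\<close>

abbreviation "SI \<equiv> simple_spectral_integral E"

lemma simple_vimage_borel: "simple_function borel p \<Longrightarrow> p -` S \<in> sets borel"
  using simple_functionD(2)[of borel p S] by simp

lemma finite_range_simple: "simple_function (borel :: 'b::topological_space measure) p \<Longrightarrow> finite (range p)"
  using simple_functionD(1)[of borel p] by simp

lemma E_vimage_simple:
  assumes "simple_function borel p" "finite J"
  shows "E (p -` J) x = (\<Sum>b\<in>J. E (p -` {b}) x)"
proof -
  have "p -` J = (\<Union>b\<in>J. p -` {b})" by auto
  then show ?thesis
    using assms by (auto intro!: E_UN_finite simp: simple_vimage_borel disjoint_family_on_def)
qed

text \<open>The defining sum runs over the values of the integrand. This version runs over the level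
  sets of a finer function \<open>p\<close>, whose values \<open>\<phi>\<close> may merge, so that
  several integrands can share one partition.\<close>

lemma SI_partition:
  assumes p: "simple_function borel p" and R: "finite R" "range p \<subseteq> R"
  shows "SI (\<lambda>z. \<phi> (p z)) x = (\<Sum>b\<in>R. \<phi> b *\<^sub>C E (p -` {b}) x)"
proof -
  let ?P = "range p"
  have fin: "finite ?P" using R finite_subset by blast
  have "(\<Sum>b\<in>R. \<phi> b *\<^sub>C E (p -` {b}) x) = (\<Sum>b\<in>?P. \<phi> b *\<^sub>C E (p -` {b}) x)"
  proof (rule sum.mono_neutral_right[OF R], safe)
    fix b assume "b \<notin> range p"
    then have "p -` {b} = {}" by auto
    then show "\<phi> b *\<^sub>C E (p -` {b}) x = 0" by simp
  qed
  also have "\<dots> = (\<Sum>c\<in>\<phi> ` ?P. \<Sum>b | b \<in> ?P \<and> \<phi> b = c. \<phi> b *\<^sub>C E (p -` {b}) x)"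
    by (rule sum.image_gen[OF fin])
  also have "\<dots> = (\<Sum>c\<in>\<phi> ` ?P. c *\<^sub>C E ((\<lambda>z. \<phi> (p z)) -` {c}) x)"
  proof (intro sum.cong refl)
    fix c
    have "(\<lambda>z. \<phi> (p z)) -` {c} = p -` {b \<in> ?P. \<phi> b = c}" by auto
    moreover have "E (p -` {b \<in> ?P. \<phi> b = c}) x = (\<Sum>b | b \<in> ?P \<and> \<phi> b = c. E (p -` {b}) x)"
      using fin by (intro E_vimage_simple p) auto
    ultimately show "(\<Sum>b | b \<in> ?P \<and> \<phi> b = c. \<phi> b *\<^sub>C E (p -` {b}) x)
        = c *\<^sub>C E ((\<lambda>z. \<phi> (p z)) -` {c}) x"
      by (simp add: scaleC_sum_right)
  qed
  finally show ?thesis by (simp add: simple_spectral_integral_def image_image)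
qed

lemma SI_clinear: "simple_function borel s \<Longrightarrow> bounded_clinear (SI s)"
  unfolding simple_spectral_integral_def[abs_def]
  by (intro bounded_clinear_sum bounded_clinear_scaleC E_clinear simple_vimage_borel)

text \<open>Subset sums of the vectors \<open>E (s -\<dots>) x\<close> over level sets are again
  values of \<open>E\<close>, hence uniformly bounded. The estimate thus depends only on the
  supremum of \<open>s\<close>, not on the number of its values.\<close>

lemma SI_bound:
  assumes s: "simple_function borel s" and c: "\<And>z. cmod (s z) \<le> c" "c > 0"
  shows "norm (SI s x) \<le> 4 * c * bound * norm x"
proof -
  have "norm (SI s x) \<le> 4 * c * (bound * norm x)"
    unfolding simple_spectral_integral_def
  proof (rule norm_sum_scaleC_le)
    fix J assume "J \<subseteq> range s"
    then have "finite J" using finite_range_simple[OF s] finite_subset by blast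
    then show "norm (\<Sum>b\<in>J. E (s -` {b}) x) \<le> bound * norm x"
      using E_bound[OF simple_vimage_borel[OF s]] E_vimage_simple[OF s] by metis
  qed (use c finite_range_simple[OF s] in auto)
  then show ?thesis by (simp add: algebra_simps)
qed

text \<open>The pair of \<open>s\<close> and \<open>t\<close> is itself a simple function and
  provides their common partition; the algebraic rules below then hold term by term.\<close>

lemma SI_pair:
  assumes s: "simple_function borel s" and t: "simple_function borel t"
  shows "SI (\<lambda>z. \<phi> (s z) (t z)) x
    = (\<Sum>c\<in>range s. \<Sum>d\<in>range t. \<phi> c d *\<^sub>C E (s -` {c} \<inter> t -` {d}) x)"
proof -
  have "SI (\<lambda>z. (\<lambda>(c, d). \<phi> c d) (s z, t z)) x
      = (\<Sum>b\<in>range s \<times> range t. (\<lambda>(c, d). \<phi> c d) b *\<^sub>C E ((\<lambda>z. (s z, t z)) -` {b}) x)"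
    using s t by (intro SI_partition) (auto simp: finite_range_simple)
  also have "\<dots> = (\<Sum>(c, d)\<in>range s \<times> range t. \<phi> c d *\<^sub>C E (s -` {c} \<inter> t -` {d}) x)"
    by (intro sum.cong refl) (auto simp: vimage_def Int_def)
  finally show ?thesis by (simp add: sum.cartesian_product)
qed

lemma SI_add:
  assumes s: "simple_function borel s" and t: "simple_function borel t"
  shows "SI (\<lambda>z. s z + t z) x = SI s x + SI t x"
  using SI_pair[OF s t, of "\<lambda>c d. c + d" x] SI_pair[OF s t, of "\<lambda>c d. c" x] SI_pair[OF s t, of "\<lambda>c d. d" x]
  by (simp add: scaleC_add_left sum.distrib)

lemma SI_diff:
  assumes s: "simple_function borel s" and t: "simple_function borel t"
  shows "SI (\<lambda>z. s z - t z) x = SI s x - SI t x"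
  using SI_pair[OF s t, of "\<lambda>c d. c - d" x] SI_pair[OF s t, of "\<lambda>c d. c" x] SI_pair[OF s t, of "\<lambda>c d. d" x]
  by (simp add: scaleC_diff_left sum_subtractf)

lemma SI_mult:
  assumes s: "simple_function borel s" and t: "simple_function borel t"
  shows "SI (\<lambda>z. s z * t z) x = SI s (SI t x)"
proof -
  have "SI s (SI t x) = (\<Sum>c\<in>range s. c *\<^sub>C E (s -` {c}) (\<Sum>d\<in>range t. d *\<^sub>C E (t -` {d}) x))"
    by (simp add: simple_spectral_integral_def)
  also have "\<dots> = (\<Sum>c\<in>range s. \<Sum>d\<in>range t. (c * d) *\<^sub>C E (s -` {c} \<inter> t -` {d}) x)"
    by (intro sum.cong refl)
       (simp add: bounded_clinear_sum_eq bounded_clinear_scaleC_eq E_clinear E_Int scaleC_sum_right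
         scaleC_scaleC simple_vimage_borel[OF s] simple_vimage_borel[OF t])
  finally show ?thesis using SI_pair[OF s t, of "(*)"] by simp
qed

lemma SI_const: "SI (\<lambda>z. c) x = c *\<^sub>C x"
  by (simp add: simple_spectral_integral_def vimage_def)

lemma SI_indicator:
  assumes \<delta>: "\<delta> \<in> sets borel"
  shows "SI (indicator \<delta>) x = E \<delta> x"
proof -
  have "simple_function borel (\<lambda>z. z \<in> \<delta>)"
  proof -
    have "(\<lambda>z. z \<in> \<delta>) -` {b} = (if b then \<delta> else - \<delta>)" for b by auto
    then show ?thesis using \<delta> by (auto simp: simple_function_def)
  qed
  from SI_partition[OF this finite subset_UNIV, of "\<lambda>b. if b then 1 else 0" x]
  have "SI (\<lambda>z. if z \<in> \<delta> then 1 else 0) x = E ((\<lambda>z. z \<in> \<delta>) -` {True}) x"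
    by (simp add: UNIV_bool)
  moreover have "(\<lambda>z. z \<in> \<delta>) -` {True} = \<delta>" by auto
  moreover have "(\<lambda>z. if z \<in> \<delta> then 1 else 0) = (indicator \<delta> :: complex \<Rightarrow> complex)"
    by (auto simp: indicator_def)
  ultimately show ?thesis by simp
qed

end

section \<open>Bounded Borel functions and their simple approximations\<close>

definition bdd_borel :: "(complex \<Rightarrow> complex) \<Rightarrow> bool" where
  "bdd_borel g \<longleftrightarrow> g \<in> borel_measurable borel \<and> bounded (range g)"

lemma bdd_borelI: "g \<in> borel_measurable borel \<Longrightarrow> (\<And>z. cmod (g z) \<le> c) \<Longrightarrow> bdd_borel g"
  by (auto simp: bdd_borel_def bounded_iff)

lemma bdd_borel_bound:
  assumes "bdd_borel g"
  shows "\<exists>c>0. \<forall>z. cmod (g z) \<le> c"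
  using assms by (force simp: bdd_borel_def bounded_pos)

lemma bdd_borel_const: "bdd_borel (\<lambda>z. c)"
  by (rule bdd_borelI[of _ "cmod c"]) auto

lemma bdd_borel_indicator: "\<delta> \<in> sets borel \<Longrightarrow> bdd_borel (indicator \<delta>)"
  by (rule bdd_borelI[of _ 1]) (auto simp: indicator_def)

lemma bdd_borel_add: "bdd_borel g \<Longrightarrow> bdd_borel h \<Longrightarrow> bdd_borel (\<lambda>z. g z + h z)"
  by (auto simp: bdd_borel_def intro: bounded_plus_comp)

lemma bdd_borel_mult:
  assumes "bdd_borel g" "bdd_borel h"
  shows "bdd_borel (\<lambda>z. g z * h z)"
proof -
  obtain c d where "c > 0" "\<And>z. cmod (g z) \<le> c" "d > 0" "\<And>z. cmod (h z) \<le> d"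
    using bdd_borel_bound[OF assms(1)] bdd_borel_bound[OF assms(2)] by blast
  then show ?thesis
    using assms by (intro bdd_borelI[of _ "c * d"]) (auto simp: bdd_borel_def norm_mult intro: mult_mono less_imp_le)
qed

text \<open>Real and imaginary parts are rounded down to multiples of \<open>1 / Suc n\<close>, each
  causing an error of at most one mesh width. Since \<open>g\<close> is bounded, only finitely many
  grid points occur.\<close>

lemma simple_approximation:
  assumes "bdd_borel g"
  shows "\<exists>s. (\<forall>n. simple_function borel (s n)) \<and> (\<forall>n z. cmod (s n z - g z) \<le> 2 / real (Suc n))"
proof -
  obtain c where c: "c > 0" "\<And>z. cmod (g z) \<le> c" using bdd_borel_bound[OF assms] by blast
  have g [measurable]: "g \<in> borel_measurable borel" using assms by (simp add: bdd_borel_def)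
  define q where "q n x = real_of_int \<lfloor>x * real (Suc n)\<rfloor> / real (Suc n)" for n x
  define s where "s n z = complex_of_real (q n (Re (g z))) + \<i> * complex_of_real (q n (Im (g z)))" for n z
  have q: "\<bar>q n x - x\<bar> \<le> 1 / real (Suc n)" for n x
  proof -
    have "q n x - x = (real_of_int \<lfloor>x * real (Suc n)\<rfloor> - x * real (Suc n)) / real (Suc n)"
      by (simp add: q_def diff_divide_distrib)
    moreover have "\<bar>real_of_int \<lfloor>x * real (Suc n)\<rfloor> - x * real (Suc n)\<bar> \<le> 1" by linarith
    ultimately show ?thesis by (simp add: divide_right_mono)
  qed
  have [measurable]: "q n \<in> borel_measurable borel" for n
    unfolding q_def by measurable
  have "simple_function borel (s n)" for n
  proof (rule simple_function_borel_measurable)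
    show "s n \<in> borel_measurable borel" unfolding s_def[abs_def] by measurable
    \<comment> \<open>The added 1 absorbs the rounding down of negative coordinates.\<close>
    let ?N = "\<lceil>c * real (Suc n)\<rceil> + 1"
    let ?e = "\<lambda>(a, b). complex_of_real (real_of_int a / real (Suc n)) + \<i> * complex_of_real (real_of_int b / real (Suc n))"
    have *: "\<lfloor>x * real (Suc n)\<rfloor> \<in> {-?N..?N}" if "\<bar>x\<bar> \<le> c" for x
    proof -
      have "\<bar>x * real (Suc n)\<bar> \<le> c * real (Suc n)" using that by (simp add: abs_mult mult_right_mono)
      then show ?thesis unfolding atLeastAtMost_iff by linarith
    qed
    have "s n ` UNIV \<subseteq> ?e ` ({-?N..?N} \<times> {-?N..?N})"
    proof
      fix w assume "w \<in> range (s n)"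
      then obtain z where w: "w = s n z" by auto
      have "\<bar>Re (g z)\<bar> \<le> c" "\<bar>Im (g z)\<bar> \<le> c"
        using c(2)[of z] abs_Re_le_cmod[of "g z"] abs_Im_le_cmod[of "g z"] by linarith+
      then show "w \<in> ?e ` ({-?N..?N} \<times> {-?N..?N})"
        unfolding w s_def q_def
        by (intro image_eqI[of _ _ "(\<lfloor>Re (g z) * real (Suc n)\<rfloor>, \<lfloor>Im (g z) * real (Suc n)\<rfloor>)"] SigmaI *) simp_all
    qed
    then show "finite (s n ` space borel)" by (simp add: finite_subset)
  qed
  moreover have "cmod (s n z - g z) \<le> 2 / real (Suc n)" for n z
  proof -
    have "cmod (s n z - g z) \<le> \<bar>q n (Re (g z)) - Re (g z)\<bar> + \<bar>q n (Im (g z)) - Im (g z)\<bar>"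
      using cmod_le[of "s n z - g z"] by (simp add: s_def)
    also have "\<dots> \<le> 1 / real (Suc n) + 1 / real (Suc n)"
      by (intro add_mono q)
    finally show ?thesis by simp
  qed
  ultimately show ?thesis by blast
qed

section \<open>Extension of the integral to bounded Borel functions\<close>

context spectral_resolution
begin

text \<open>Two uniform approximations of \<open>g\<close> differ uniformly by little, so by
  \<open>SI_bound\<close> their integrals have the same limit. Hence the limit operator is
  independent of the approximation, which makes the definite description in
  \<open>spectral_integral\<close> meaningful.\<close>

lemma has_spectral_integral_imp_tendsto:
  assumes B: "has_spectral_integral E g B"
    and s: "\<And>n. simple_function borel (s n)" "uniform_limit UNIV s g sequentially"
  shows "(\<lambda>n. SI (s n) x) \<longlonglongrightarrow> B x"
proof -
  obtain t where t: "\<And>n. simple_function borel (t n)" "uniform_limit UNIV t g sequentially"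
    and lim: "(\<lambda>n. onorm (\<lambda>x. SI (t n) x - B x)) \<longlonglongrightarrow> 0"
    using B by (auto simp: has_spectral_integral_def)
  have "(\<lambda>n. SI (t n) x - B x) \<longlonglongrightarrow> 0"
  proof (rule tendsto_norm_zero_cancel, rule tendsto_sandwich[OF _ _ tendsto_const])
    show "(\<lambda>n. onorm (\<lambda>x. SI (t n) x - B x) * norm x) \<longlonglongrightarrow> 0"
      using tendsto_mult_left_zero[OF lim] .
    have "bounded_linear (\<lambda>x. SI (t n) x - B x)" for n
      using SI_clinear[OF t(1)] B
      by (intro bounded_linear_sub) (auto simp: has_spectral_integral_def bounded_clinear_def)
    then show "\<forall>\<^sub>F n in sequentially. norm (SI (t n) x - B x) \<le> onorm (\<lambda>x. SI (t n) x - B x) * norm x"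
      by (intro always_eventually allI onorm)
  qed simp
  moreover have "(\<lambda>n. SI (s n) x - SI (t n) x) \<longlonglongrightarrow> 0"
  proof (rule LIMSEQ_I)
    fix r :: real assume r: "r > 0"
    \<comment> \<open>With \<open>norm x + 1\<close> in place of \<open>norm x\<close> the quotient
      is also sensible for \<open>x = 0\<close>; the estimate below then ends at
      \<open>r / 2\<close>.\<close>
    define e where "e = r / (8 * bound * (norm x + 1))"
    have e: "e > 0" using r bound_pos by (simp add: e_def add_nonneg_pos)
    have "uniform_limit UNIV (\<lambda>n z. s n z - t n z) (\<lambda>z. g z - g z) sequentially"
      by (intro uniform_limit_minus s t)
    then have "\<forall>\<^sub>F n in sequentially. \<forall>z. cmod (s n z - t n z) < e"
      using e by (auto simp: uniform_limit_iff)
    then obtain N where N: "\<And>n z. n \<ge> N \<Longrightarrow> cmod (s n z - t n z) < e"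
      by (auto simp: eventually_sequentially)
    have "norm (SI (s n) x - SI (t n) x) < r" if "n \<ge> N" for n
    proof -
      have "norm (SI (s n) x - SI (t n) x) = norm (SI (\<lambda>z. s n z - t n z) x)"
        by (simp add: SI_diff s t)
      also have "\<dots> \<le> 4 * e * bound * norm x"
        using N[OF that] e s(1) t(1) by (intro SI_bound) (auto intro: less_imp_le)
      also have "\<dots> \<le> 4 * e * bound * (norm x + 1)"
        using e bound_pos by simp
      also have "\<dots> = r / 2"
      proof -
        have "norm x + 1 > 0" by (simp add: add_nonneg_pos)
        then have "8 * bound * (norm x + 1) \<noteq> 0" using bound_pos by simp
        then have "e * (8 * bound * (norm x + 1)) = r"
          using e_def nonzero_eq_divide_eq by blast
        then show ?thesis by (simp add: algebra_simps)
      qed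
      also have "\<dots> < r" using r by simp
      finally show ?thesis .
    qed
    then show "\<exists>N. \<forall>n\<ge>N. norm (SI (s n) x - SI (t n) x - 0) < r" by auto
  qed
  ultimately have "(\<lambda>n. (SI (s n) x - SI (t n) x) + (SI (t n) x - B x) + B x) \<longlonglongrightarrow> 0 + 0 + B x"
    by (intro tendsto_add tendsto_const)
  then show ?thesis by simp
qed

lemma simple_approximation_uniform:
  assumes "\<And>n z. cmod (s n z - g z) \<le> 2 / real (Suc n)"
  shows "uniform_limit UNIV s g sequentially"
proof (rule uniform_limitI)
  fix e :: real assume "e > 0"
  have "(\<lambda>n. 2 / real (Suc n)) \<longlonglongrightarrow> 0"
    using LIMSEQ_Suc[OF lim_const_over_n[of 2]] .
  then have "\<forall>\<^sub>F n in sequentially. 2 / real (Suc n) < e"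
    using \<open>e > 0\<close> by (rule order_tendstoD)
  then show "\<forall>\<^sub>F n in sequentially. \<forall>z\<in>UNIV. dist (s n z) (g z) < e"
    by eventually_elim (use assms in \<open>auto simp: dist_norm intro: le_less_trans\<close>)
qed

text \<open>The integrals of the approximations are Cauchy with an explicit rate proportional to
  \<open>norm x\<close>. The rate survives in the pointwise limit and therefore gives convergence in
  operator norm.\<close>

lemma has_spectral_integral_ex:
  assumes "bdd_borel g"
  shows "\<exists>B. has_spectral_integral E g B"
proof -
  obtain s where s: "\<And>n. simple_function borel (s n)" "\<And>n z. cmod (s n z - g z) \<le> 2 / real (Suc n)"
    using simple_approximation[OF assms] by blast
  \<comment> \<open>One factor 4 comes from \<open>SI_bound\<close>, the other from the distance
    \<open>4 / Suc n\<close> between two approximations.\<close>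
  define C where "C = 16 * bound"
  have C: "C > 0" using bound_pos by (simp add: C_def)
  have diff: "norm (SI (s m) x - SI (s n) x) \<le> C * norm x / real (Suc n)" if "n \<le> m" for m n x
  proof -
    have "cmod (s m z - s n z) \<le> 4 / real (Suc n)" for z
    proof -
      have "cmod (s m z - s n z) \<le> cmod (s m z - g z) + cmod (s n z - g z)"
        using norm_triangle_ineq4[of "s m z - g z" "s n z - g z"] by simp
      also have "\<dots> \<le> 2 / real (Suc n) + 2 / real (Suc n)"
        using that by (intro add_mono order_trans[OF s(2)] divide_left_mono) auto
      finally show ?thesis by simp
    qed
    then have "norm (SI (\<lambda>z. s m z - s n z) x) \<le> 4 * (4 / real (Suc n)) * bound * norm x"
      using s(1) by (intro SI_bound) auto
    then show ?thesis using s(1) by (simp add: SI_diff C_def)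
  qed
  have C_lim: "(\<lambda>n. C * a / real (Suc n)) \<longlonglongrightarrow> 0" for a
    using LIMSEQ_Suc[OF lim_const_over_n] .
  have "Cauchy (\<lambda>n. SI (s n) x)" for x
  proof (rule metric_CauchyI)
    fix e :: real assume "e > 0"
    then have "\<forall>\<^sub>F n in sequentially. C * norm x / real (Suc n) < e / 2"
      by (intro order_tendstoD[OF C_lim]) simp
    then obtain N where N: "C * norm x / real (Suc N) < e / 2"
      by (auto simp: eventually_sequentially)
    have *: "dist (SI (s n) x) (SI (s N) x) < e / 2" if "n \<ge> N" for n
      using le_less_trans[OF diff[OF that, of x] N] by (simp only: dist_norm)
    show "\<exists>N. \<forall>m\<ge>N. \<forall>n\<ge>N. dist (SI (s m) x) (SI (s n) x) < e"
      using * dist_triangle_half_l by blast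
  qed
  then have "\<forall>x. \<exists>y. (\<lambda>n. SI (s n) x) \<longlonglongrightarrow> y"
    by (simp add: Cauchy_convergent_iff convergent_def)
  then obtain B where "\<forall>x. (\<lambda>n. SI (s n) x) \<longlonglongrightarrow> B x"
    by (rule choice[THEN exE])
  then have B: "(\<lambda>n. SI (s n) x) \<longlonglongrightarrow> B x" for x
    by blast
  have le: "norm (SI (s n) x - B x) \<le> C * norm x / real (Suc n)" for n x
  proof (rule LIMSEQ_le_const2)
    show "(\<lambda>m. norm (SI (s n) x - SI (s m) x)) \<longlonglongrightarrow> norm (SI (s n) x - B x)"
      by (intro tendsto_intros B)
    show "\<exists>N. \<forall>m\<ge>N. norm (SI (s n) x - SI (s m) x) \<le> C * norm x / real (Suc n)"
      using diff[of n _ x] by (auto simp: norm_minus_commute)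
  qed
  have Bc: "bounded_clinear B"
    unfolding bounded_clinear_def
  proof safe
    fix c x
    have "(\<lambda>n. SI (s n) (c *\<^sub>C x)) \<longlonglongrightarrow> c *\<^sub>C B x"
      using tendsto_scaleC[OF B, of c x] s(1) by (simp add: bounded_clinear_scaleC_eq SI_clinear)
    then show eq: "B (c *\<^sub>C x) = c *\<^sub>C B x" using B LIMSEQ_unique by blast
  next
    show "bounded_linear B"
    proof (rule bounded_linear_intro)
      fix x y
      have "(\<lambda>n. SI (s n) (x + y)) \<longlonglongrightarrow> B x + B y"
        using tendsto_add[OF B[of x] B[of y]] s(1) by (simp add: bounded_clinear_add_eq SI_clinear)
      then show "B (x + y) = B x + B y" using B LIMSEQ_unique by blast
    next
      fix r :: real and x
      have "(\<lambda>n. SI (s n) (r *\<^sub>R x)) \<longlonglongrightarrow> r *\<^sub>R B x"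
        using tendsto_scaleR[OF tendsto_const B[of x]] s(1) by (simp add: bounded_clinear_scaleR_eq SI_clinear)
      then show "B (r *\<^sub>R x) = r *\<^sub>R B x" using B LIMSEQ_unique by blast
    next
      fix x
      have "norm (SI (s 0) x) \<le> onorm (SI (s 0)) * norm x"
        using SI_clinear[OF s(1)] by (intro onorm bounded_clinear_bounded_linear)
      then show "norm (B x) \<le> norm x * (onorm (SI (s 0)) + C)"
        using le[of 0 x] norm_triangle_ineq2[of "B x" "SI (s 0) x"]
        by (simp add: algebra_simps norm_minus_commute)
    qed
  qed
  have "(\<lambda>n. onorm (\<lambda>x. SI (s n) x - B x)) \<longlonglongrightarrow> 0"
  proof (rule tendsto_sandwich[OF _ _ tendsto_const C_lim[of 1]])
    have "bounded_linear (\<lambda>x. SI (s n) x - B x)" for n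
      using SI_clinear[OF s(1)] Bc by (intro bounded_linear_sub bounded_clinear_bounded_linear)
    then show "\<forall>\<^sub>F n in sequentially. 0 \<le> onorm (\<lambda>x. SI (s n) x - B x)"
      by (intro always_eventually allI onorm_pos_le)
    show "\<forall>\<^sub>F n in sequentially. onorm (\<lambda>x. SI (s n) x - B x) \<le> C * 1 / real (Suc n)"
      by (intro always_eventually allI onorm_bound) (use le C in auto)
  qed
  then show ?thesis
    unfolding has_spectral_integral_def using Bc s simple_approximation_uniform by blast
qed

lemma has_spectral_integral:
  assumes "bdd_borel g"
  shows "has_spectral_integral E g (spectral_integral E g)"
proof -
  obtain s where s: "\<And>n. simple_function borel (s n)" "\<And>n z. cmod (s n z - g z) \<le> 2 / real (Suc n)"
    using simple_approximation[OF assms] by blast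
  have "B = B'" if "has_spectral_integral E g B" "has_spectral_integral E g B'" for B B'
    using that has_spectral_integral_imp_tendsto[OF _ s(1) simple_approximation_uniform[OF s(2)]]
      LIMSEQ_unique by blast
  then have "\<exists>!B. has_spectral_integral E g B" using has_spectral_integral_ex[OF assms] by blast
  then show ?thesis unfolding spectral_integral_def by (rule theI')
qed

abbreviation "\<Phi> \<equiv> spectral_integral E"

lemma \<Phi>_clinear: "bdd_borel g \<Longrightarrow> bounded_clinear (\<Phi> g)"
  using has_spectral_integral[of g] by (simp add: has_spectral_integral_def)

lemma \<Phi>_tendsto:
  "bdd_borel g \<Longrightarrow> (\<And>n. simple_function borel (s n)) \<Longrightarrow> uniform_limit UNIV s g sequentially \<Longrightarrow>
     (\<lambda>n. SI (s n) x) \<longlonglongrightarrow> \<Phi> g x"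
  using has_spectral_integral has_spectral_integral_imp_tendsto by blast

lemma \<Phi>_simple:
  assumes "simple_function borel s" "bdd_borel s"
  shows "\<Phi> s x = SI s x"
  using \<Phi>_tendsto[OF assms(2), of "\<lambda>_. s" x] assms(1) by (simp add: LIMSEQ_const_iff uniform_limit_const)

lemma \<Phi>_const: "\<Phi> (\<lambda>z. c) x = c *\<^sub>C x"
  by (simp add: \<Phi>_simple bdd_borel_const SI_const)

lemma \<Phi>_indicator: "\<delta> \<in> sets borel \<Longrightarrow> \<Phi> (indicator \<delta>) x = E \<delta> x"
  by (simp add: \<Phi>_simple bdd_borel_indicator SI_indicator)

lemma \<Phi>_add:
  assumes g: "bdd_borel g" and h: "bdd_borel h"
  shows "\<Phi> (\<lambda>z. g z + h z) x = \<Phi> g x + \<Phi> h x"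
proof -
  obtain s where s: "\<And>n. simple_function borel (s n)" "\<And>n z. cmod (s n z - g z) \<le> 2 / real (Suc n)"
    using simple_approximation[OF g] by blast
  obtain t where t: "\<And>n. simple_function borel (t n)" "\<And>n z. cmod (t n z - h z) \<le> 2 / real (Suc n)"
    using simple_approximation[OF h] by blast
  note u = simple_approximation_uniform[OF s(2)] simple_approximation_uniform[OF t(2)]
  have "(\<lambda>n. SI (\<lambda>z. s n z + t n z) x) \<longlonglongrightarrow> \<Phi> (\<lambda>z. g z + h z) x"
    by (intro \<Phi>_tendsto bdd_borel_add g h simple_function_add s t uniform_limit_add u)
  moreover have "(\<lambda>n. SI (\<lambda>z. s n z + t n z) x) \<longlonglongrightarrow> \<Phi> g x + \<Phi> h x"
    using tendsto_add[OF \<Phi>_tendsto[OF g s(1) u(1)] \<Phi>_tendsto[OF h t(1) u(2)]] s t by (simp add: SI_add)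
  ultimately show ?thesis by (rule LIMSEQ_unique)
qed

lemma \<Phi>_bound:
  assumes g: "bdd_borel g" and c: "\<And>z. cmod (g z) \<le> c"
  shows "norm (\<Phi> g x) \<le> 4 * c * bound * norm x"
proof -
  obtain s where s: "\<And>n. simple_function borel (s n)" "\<And>n z. cmod (s n z - g z) \<le> 2 / real (Suc n)"
    using simple_approximation[OF g] by blast
  have "c \<ge> 0" using c[of 0] norm_ge_zero order_trans by blast
  \<comment> \<open>\<open>SI_bound\<close> asks for a strictly positive bound. This one is positive
    even for \<open>c = 0\<close> and decreases to \<open>c\<close>.\<close>
  have "cmod (s n z) \<le> c + 2 / real (Suc n)" for n z
    using c[of z] s(2)[of n z] norm_triangle_ineq2[of "s n z" "g z"] by linarith
  then have "norm (SI (s n) x) \<le> 4 * (c + 2 / real (Suc n)) * bound * norm x" for n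
    using s(1) \<open>c \<ge> 0\<close> by (intro SI_bound) (auto intro: add_nonneg_pos)
  moreover have "(\<lambda>n. 4 * (c + 2 / real (Suc n)) * bound * norm x) \<longlonglongrightarrow> 4 * (c + 0) * bound * norm x"
    by (intro tendsto_intros LIMSEQ_Suc[OF lim_const_over_n])
  moreover have "(\<lambda>n. norm (SI (s n) x)) \<longlonglongrightarrow> norm (\<Phi> g x)"
    by (intro tendsto_norm \<Phi>_tendsto g s simple_approximation_uniform)
  ultimately show ?thesis by (auto intro: LIMSEQ_le)
qed

lemma \<Phi>_mult:
  assumes g: "bdd_borel g" and h: "bdd_borel h"
  shows "\<Phi> (\<lambda>z. g z * h z) x = \<Phi> g (\<Phi> h x)"
proof -
  obtain s where s: "\<And>n. simple_function borel (s n)" "\<And>n z. cmod (s n z - g z) \<le> 2 / real (Suc n)"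
    using simple_approximation[OF g] by blast
  obtain t where t: "\<And>n. simple_function borel (t n)" "\<And>n z. cmod (t n z - h z) \<le> 2 / real (Suc n)"
    using simple_approximation[OF h] by blast
  obtain c where c: "c > 0" "\<And>z. cmod (g z) \<le> c" using bdd_borel_bound[OF g] by blast
  note u = simple_approximation_uniform[OF s(2)] simple_approximation_uniform[OF t(2)]
  let ?y = "\<Phi> h x"
  have "(\<lambda>n. SI (\<lambda>z. s n z * t n z) x) \<longlonglongrightarrow> \<Phi> (\<lambda>z. g z * h z) x"
  proof (intro \<Phi>_tendsto bdd_borel_mult g h simple_function_mult s t uniform_lim_mult u)
    show "bounded (range g)" "bounded (range h)" using g h by (auto simp: bdd_borel_def)
  qed
  \<comment> \<open>A product of strongly convergent operators converges because the left factors
    are uniformly bounded: all \<open>s n\<close> are bounded by \<open>c + 2\<close>, the first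
    error \<open>2 / Suc 0\<close> being the largest.\<close>
  moreover have "(\<lambda>n. SI (s n) (SI (t n) x - ?y)) \<longlonglongrightarrow> 0"
  proof (rule Lim_null_comparison)
    have "cmod (s n z) \<le> c + 2" for n z
      using c(2)[of z] s(2)[of n z] norm_triangle_ineq2[of "s n z" "g z"]
        divide_left_mono[of 1 "real (Suc n)" 2] by simp
    then show "\<forall>\<^sub>F n in sequentially. norm (SI (s n) (SI (t n) x - ?y))
        \<le> 4 * (c + 2) * bound * norm (SI (t n) x - ?y)"
      using c(1) s(1) by (intro always_eventually allI SI_bound) auto
    show "(\<lambda>n. 4 * (c + 2) * bound * norm (SI (t n) x - ?y)) \<longlonglongrightarrow> 0"
      using \<Phi>_tendsto[OF h t(1) u(2), of x]
      by (intro tendsto_mult_right_zero tendsto_norm_zero) (simp add: LIM_zero)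
  qed
  then have "(\<lambda>n. SI (s n) (SI (t n) x - ?y) + SI (s n) ?y) \<longlonglongrightarrow> 0 + \<Phi> g ?y"
    by (intro tendsto_add \<Phi>_tendsto g s u)
  then have "(\<lambda>n. SI (\<lambda>z. s n z * t n z) x) \<longlonglongrightarrow> \<Phi> g ?y"
    using s(1) t(1) by (simp add: SI_mult bounded_clinear_diff_eq[OF SI_clinear])
  ultimately show ?thesis by (rule LIMSEQ_unique)
qed

end

section \<open>Continuous functions of a spectral measure\<close>

text \<open>The relation between \<open>B\<close> and \<open>f\<close> is required only for bounded
  Borel sets, where \<open>f\<close> is bounded and its integral is available. Closedness of
  \<open>B\<close> determines the rest by limits. The same locale thus serves the unbounded
  generator and the bounded semigroup operators.\<close>

locale spectral_function = spectral_resolution E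
  for E :: "complex set \<Rightarrow> 'a::complex_banach \<Rightarrow> 'a" +
  fixes f :: "complex \<Rightarrow> complex" and D :: "'a set" and B :: "'a \<Rightarrow> 'a"
  assumes continuous: "continuous_on UNIV f"
    and linear: "linear_operator D B"
    and closed: "closed_operator D B"
    and E_domain: "\<delta> \<in> sets borel \<Longrightarrow> bounded \<delta> \<Longrightarrow> E \<delta> x \<in> D"
    and B_E: "\<delta> \<in> sets borel \<Longrightarrow> bounded \<delta> \<Longrightarrow> B (E \<delta> x) = \<Phi> (\<lambda>z. f z * indicator \<delta> z) x"
    and E_B: "\<delta> \<in> sets borel \<Longrightarrow> bounded \<delta> \<Longrightarrow> x \<in> D \<Longrightarrow>
               E \<delta> (B x) = \<Phi> (\<lambda>z. f z * indicator \<delta> z) x"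

lemma bdd_borel_mult_indicator:
  assumes f: "continuous_on UNIV f" and \<delta>: "\<delta> \<in> sets borel" "bounded \<delta>"
  shows "bdd_borel (\<lambda>z. f z * indicator \<delta> z)"
proof -
  have "compact (f ` closure \<delta>)"
    using \<delta> by (intro compact_continuous_image continuous_on_subset[OF f]) (auto simp: compact_closure)
  then obtain c where c: "\<And>z. z \<in> closure \<delta> \<Longrightarrow> cmod (f z) \<le> c"
    using compact_imp_bounded bounded_iff by (metis imageI)
  have "f \<in> borel_measurable borel" using f by (rule borel_measurable_continuous_onI)
  then have "(\<lambda>z. f z * indicator \<delta> z) \<in> borel_measurable borel"
    using \<delta> by measurable
  moreover have "cmod (f z * indicator \<delta> z) \<le> max c 0" for z
    using c[of z] closure_subset[of \<delta>] by (auto simp: indicator_def)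
  ultimately show ?thesis by (rule bdd_borelI)
qed

text \<open>Discs exhaust the plane; this limit carries statements from bounded sets over to all of
  the space.\<close>

lemma (in spectral_resolution) E_cball_tendsto: "(\<lambda>n. E (cball 0 (real n)) x) \<longlonglongrightarrow> x"
proof -
  have "(\<Union>n. cball 0 (real n)) = (UNIV :: complex set)"
    using real_arch_simple by auto
  then show ?thesis
    using E_incseq[of "\<lambda>n. cball 0 (real n)" x] by (simp add: incseq_def subset_cball)
qed

lemma (in spectral_resolution) E_Int_cball_tendsto:
  assumes "\<delta> \<in> sets borel"
  shows "(\<lambda>n. E (cball 0 (real n) \<inter> \<delta>) x) \<longlonglongrightarrow> E \<delta> x"
  using E_cball_tendsto[of "E \<delta> x"] assms by (simp add: E_Int)

lemma (in spectral_resolution) E_zero_if_bounded_zero: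
  assumes "\<delta> \<in> sets borel" "\<And>n. E (cball 0 (real n) \<inter> \<delta>) x = 0"
  shows "E \<delta> x = 0"
  using E_Int_cball_tendsto[OF assms(1), of x] assms(2) by (simp add: LIMSEQ_const_iff)

lemma (in spectral_resolution) E_Compl:
  assumes "\<delta> \<in> sets borel"
  shows "E (- \<delta>) x = x - E \<delta> x"
  using E_Un[of \<delta> "- \<delta>" x] assms by (simp add: borel_comp algebra_simps)

lemma (in spectral_resolution) E_idem: "\<delta> \<in> sets borel \<Longrightarrow> E \<delta> (E \<delta> x) = E \<delta> x"
  using E_Int[of \<delta> \<delta> x] by simp

section \<open>The shifted operator and its partial inverses\<close>

context spectral_function
begin

lemma f_borel [measurable]: "f \<in> borel_measurable borel"
  using continuous by (rule borel_measurable_continuous_onI)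

lemma bdd_f_indicator: "\<delta> \<in> sets borel \<Longrightarrow> bounded \<delta> \<Longrightarrow> bdd_borel (\<lambda>z. (f z - \<mu>) * indicator \<delta> z)"
  by (intro bdd_borel_mult_indicator continuous_intros continuous)

lemma domain_diff: "x \<in> D \<Longrightarrow> y \<in> D \<Longrightarrow> x - y \<in> D"
  and B_diff: "x \<in> D \<Longrightarrow> y \<in> D \<Longrightarrow> B (x - y) = B x - B y"
proof -
  assume xy: "x \<in> D" "y \<in> D"
  have "(-1) *\<^sub>C z = - z" for z :: 'a
    using scaleC_diff_left[of 0 1 z] by simp
  then show "x - y \<in> D" "B (x - y) = B x - B y"
    using linear xy unfolding linear_operator_def by (metis add_uminus_conv_diff)+
qed

lemma domain_0: "0 \<in> D" and B_0: "B 0 = 0"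
  using linear B_diff[of 0 0] by (auto simp: linear_operator_def)

lemma shifted_0: "shifted B \<mu> 0 = 0"
  by (simp add: shifted_def B_0)

lemma shifted_diff: "x \<in> D \<Longrightarrow> y \<in> D \<Longrightarrow> shifted B \<mu> (x - y) = shifted B \<mu> x - shifted B \<mu> y"
  by (simp add: shifted_def B_diff scaleC_diff_right)

lemma inj_on_shifted_iff: "inj_on (shifted B \<mu>) D \<longleftrightarrow> (\<forall>x\<in>D. shifted B \<mu> x = 0 \<longrightarrow> x = 0)"
proof safe
  fix x assume "inj_on (shifted B \<mu>) D" "x \<in> D" "shifted B \<mu> x = 0"
  then show "x = 0" using inj_onD[of _ D x 0] domain_0 shifted_0 by metis
next
  assume *: "\<forall>x\<in>D. shifted B \<mu> x = 0 \<longrightarrow> x = 0"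
  show "inj_on (shifted B \<mu>) D"
  proof (rule inj_onI)
    fix x y assume "x \<in> D" "y \<in> D" "shifted B \<mu> x = shifted B \<mu> y"
    then have "shifted B \<mu> (x - y) = 0" "x - y \<in> D" by (simp_all add: shifted_diff domain_diff)
    then have "x - y = 0" using * by blast
    then show "x = y" by simp
  qed
qed

lemma \<Phi>_shift:
  assumes "\<delta> \<in> sets borel" "bounded \<delta>"
  shows "\<Phi> (\<lambda>z. (f z - \<mu>) * indicator \<delta> z) x = \<Phi> (\<lambda>z. f z * indicator \<delta> z) x - \<mu> *\<^sub>C E \<delta> x"
proof -
  have i: "bdd_borel (indicator \<delta>)" using assms by (simp add: bdd_borel_indicator)
  have "\<Phi> (\<lambda>z. f z * indicator \<delta> z + (- \<mu>) * indicator \<delta> z) x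
      = \<Phi> (\<lambda>z. f z * indicator \<delta> z) x + \<Phi> (\<lambda>z. - \<mu>) (\<Phi> (indicator \<delta>) x)"
    using bdd_f_indicator[OF assms, of 0] \<Phi>_mult[OF bdd_borel_const i, of "- \<mu>" x]
      \<Phi>_add[OF _ bdd_borel_mult[OF bdd_borel_const i], of "\<lambda>z. f z * indicator \<delta> z" "- \<mu>" x]
    by simp
  moreover have "(- \<mu>) *\<^sub>C y = - (\<mu> *\<^sub>C y)" for y :: 'a
    using scaleC_diff_left[of 0 \<mu> y] by simp
  moreover have "(f z - \<mu>) * indicator \<delta> z = f z * indicator \<delta> z + (- \<mu>) * indicator \<delta> z" for z
    by (simp add: algebra_simps)
  ultimately show ?thesis using assms by (simp only: \<Phi>_const \<Phi>_indicator add_uminus_conv_diff)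
qed

lemma shifted_E:
  assumes "\<delta> \<in> sets borel" "bounded \<delta>"
  shows "shifted B \<mu> (E \<delta> x) = \<Phi> (\<lambda>z. (f z - \<mu>) * indicator \<delta> z) x"
  using assms by (simp add: shifted_def B_E \<Phi>_shift)

lemma E_shifted:
  assumes "\<delta> \<in> sets borel" "bounded \<delta>" "x \<in> D"
  shows "E \<delta> (shifted B \<mu> x) = \<Phi> (\<lambda>z. (f z - \<mu>) * indicator \<delta> z) x"
  using assms
  by (simp add: shifted_def E_B \<Phi>_shift bounded_clinear_diff_eq bounded_clinear_scaleC_eq E_clinear)

definition inv_on :: "complex \<Rightarrow> complex set \<Rightarrow> complex \<Rightarrow> complex" where
  "inv_on \<mu> \<delta> z = indicator \<delta> z / (f z - \<mu>)"

lemma bdd_inv_on: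
  assumes "\<delta> \<in> sets borel" "e > 0" "\<And>z. z \<in> \<delta> \<Longrightarrow> cmod (f z - \<mu>) \<ge> e"
  shows "bdd_borel (inv_on \<mu> \<delta>)"
proof (rule bdd_borelI)
  show "inv_on \<mu> \<delta> \<in> borel_measurable borel"
    unfolding inv_on_def[abs_def] using assms(1) by measurable
  show "cmod (inv_on \<mu> \<delta> z) \<le> 1 / e" for z
    using assms(2) assms(3)[of z] by (auto simp: inv_on_def indicator_def norm_divide divide_simps)
qed

context
  fixes \<delta> e \<mu>
  assumes \<delta>: "\<delta> \<in> sets borel" and e: "e > 0" "\<And>z. z \<in> \<delta> \<Longrightarrow> cmod (f z - \<mu>) \<ge> e"
begin

text \<open>A localised right inverse, with the left inverse following. The set
  \<open>\<delta>\<close> may be unbounded, and \<open>\<eta>\<close> is the bounded window that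
  brings the vector into the domain; the integrands multiply to the indicator of the
  intersection.\<close>

lemma E_shift_inv_on:
  assumes \<eta>: "\<eta> \<in> sets borel" "bounded \<eta>"
  shows "shifted B \<mu> (E \<eta> (\<Phi> (inv_on \<mu> \<delta>) x)) = E (\<eta> \<inter> \<delta>) x"
proof -
  have "shifted B \<mu> (E \<eta> (\<Phi> (inv_on \<mu> \<delta>) x)) = \<Phi> (\<lambda>z. ((f z - \<mu>) * indicator \<eta> z) * inv_on \<mu> \<delta> z) x"
    using shifted_E[OF \<eta>] \<Phi>_mult[OF bdd_f_indicator[OF \<eta>] bdd_inv_on[OF \<delta> e]] by simp
  also have "(\<lambda>z. ((f z - \<mu>) * indicator \<eta> z) * inv_on \<mu> \<delta> z) = indicator (\<eta> \<inter> \<delta>)"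
    using e by (fastforce simp: inv_on_def indicator_def)
  finally show ?thesis using \<delta> \<eta> by (simp add: \<Phi>_indicator)
qed

lemma inv_on_E_shift:
  assumes \<eta>: "\<eta> \<in> sets borel" "bounded \<eta>" and x: "x \<in> D"
  shows "\<Phi> (inv_on \<mu> \<delta>) (E \<eta> (shifted B \<mu> x)) = E (\<eta> \<inter> \<delta>) x"
proof -
  have "\<Phi> (inv_on \<mu> \<delta>) (E \<eta> (shifted B \<mu> x)) = \<Phi> (\<lambda>z. inv_on \<mu> \<delta> z * ((f z - \<mu>) * indicator \<eta> z)) x"
    using E_shifted[OF \<eta> x] \<Phi>_mult[OF bdd_inv_on[OF \<delta> e] bdd_f_indicator[OF \<eta>]] by simp
  also have "(\<lambda>z. inv_on \<mu> \<delta> z * ((f z - \<mu>) * indicator \<eta> z)) = indicator (\<eta> \<inter> \<delta>)"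
    using e by (fastforce simp: inv_on_def indicator_def)
  finally show ?thesis using \<delta> \<eta> by (simp add: \<Phi>_indicator)
qed

text \<open>For bounded \<open>\<delta>\<close> the window can be \<open>\<delta>\<close> itself,
  and it disappears because the integrand vanishes off \<open>\<delta>\<close>.\<close>

lemma inv_on_shift:
  assumes "bounded \<delta>" "x \<in> D"
  shows "\<Phi> (inv_on \<mu> \<delta>) (shifted B \<mu> x) = E \<delta> x"
proof -
  have "\<Phi> (\<lambda>z. inv_on \<mu> \<delta> z * indicator \<delta> z) (shifted B \<mu> x) = \<Phi> (inv_on \<mu> \<delta>) (E \<delta> (shifted B \<mu> x))"
    using \<delta> by (simp add: \<Phi>_mult[OF bdd_inv_on[OF \<delta> e]] bdd_borel_indicator \<Phi>_indicator)
  moreover have "(\<lambda>z. inv_on \<mu> \<delta> z * indicator \<delta> z) = inv_on \<mu> \<delta>"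
    by (auto simp: inv_on_def indicator_def)
  ultimately show ?thesis using inv_on_E_shift[OF \<delta> assms(1) assms(2)] by simp
qed

end

text \<open>These sets increase to the complement of the level set of \<open>f\<close> at
  \<open>\<mu>\<close>. Each is bounded and keeps \<open>f\<close> away from \<open>\<mu>\<close>,
  so on each of them the shifted operator has a bounded inverse.\<close>

definition far :: "complex \<Rightarrow> nat \<Rightarrow> complex set" where
  "far \<mu> n = {z. cmod (f z - \<mu>) \<ge> 1 / real (Suc n)} \<inter> cball 0 (real n)"

lemma closed_far_set: "closed {z. cmod (f z - \<mu>) \<ge> r}"
  by (intro closed_Collect_le continuous_intros continuous)

lemma far_borel: "far \<mu> n \<in> sets borel" and bounded_far: "bounded (far \<mu> n)"
  using closed_far_set by (auto simp: far_def bounded_Int)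

lemma far_dist: "z \<in> far \<mu> n \<Longrightarrow> cmod (f z - \<mu>) \<ge> 1 / real (Suc n)"
  by (simp add: far_def)

lemma bdd_inv_on_far: "bdd_borel (inv_on \<mu> (far \<mu> n))"
  by (rule bdd_inv_on[OF far_borel _ far_dist]) auto

lemma inv_on_far_shift: "x \<in> D \<Longrightarrow> \<Phi> (inv_on \<mu> (far \<mu> n)) (shifted B \<mu> x) = E (far \<mu> n) x"
  by (rule inv_on_shift[OF far_borel _ far_dist bounded_far]) auto

lemma E_far_in_range: "E (far \<mu> n) x \<in> shifted B \<mu> ` D"
proof
  have "shifted B \<mu> (E (far \<mu> n) (\<Phi> (inv_on \<mu> (far \<mu> n)) x)) = E (far \<mu> n \<inter> far \<mu> n) x"
    by (rule E_shift_inv_on[OF far_borel _ far_dist far_borel bounded_far]) auto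
  then show "E (far \<mu> n) x = shifted B \<mu> (E (far \<mu> n) (\<Phi> (inv_on \<mu> (far \<mu> n)) x))"
    by simp
qed (rule E_domain[OF far_borel bounded_far])

section \<open>Point and residual spectrum\<close>

lemma level_borel: "f -` S \<in> sets borel" if "S \<in> sets borel"
  using measurable_sets[OF f_borel that] by simp

lemma far_tendsto: "(\<lambda>n. E (far \<mu> n) x) \<longlonglongrightarrow> x - E (f -` {\<mu>}) x"
proof -
  have "incseq (far \<mu>)"
  proof (rule incseq_SucI)
    fix n
    have "1 / real (Suc (Suc n)) \<le> 1 / real (Suc n)" by (intro divide_left_mono) auto
    then show "far \<mu> n \<subseteq> far \<mu> (Suc n)" unfolding far_def by fastforce
  qed
  moreover have "(\<Union>n. far \<mu> n) = - (f -` {\<mu>})"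
  proof (intro equalityI subsetI)
    fix z assume "z \<in> - (f -` {\<mu>})"
    then have "f z \<noteq> \<mu>" by auto
    then obtain n where n: "inverse (real (Suc n)) < cmod (f z - \<mu>)"
      using reals_Archimedean[of "cmod (f z - \<mu>)"] by auto
    obtain m where m: "cmod z \<le> real m" using real_arch_simple by blast
    have "1 / real (Suc (max n m)) \<le> 1 / real (Suc n)" by (intro divide_left_mono) auto
    then have "z \<in> far \<mu> (max n m)" using n m by (simp add: far_def inverse_eq_divide)
    then show "z \<in> (\<Union>n. far \<mu> n)" by blast
  qed (auto simp: far_def)
  ultimately show ?thesis
    using E_incseq[of "far \<mu>" x] far_borel by (simp add: E_Compl level_borel)
qed

text \<open>The partial inverses show that an eigenvector is annihilated by every
  \<open>E (far \<mu> n)\<close>; in the limit it lies in the range of \<open>E\<close> on the level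
  set. Conversely the integrand \<open>f - \<mu>\<close> vanishes on that set.\<close>

theorem point_spectrum_eq: "point_spectrum D B = {\<mu>. \<exists>x. E (f -` {\<mu>}) x \<noteq> 0}"
proof safe
  fix \<mu> assume "\<mu> \<in> point_spectrum D B"
  then obtain x where x: "x \<in> D" "shifted B \<mu> x = 0" "x \<noteq> 0"
    by (auto simp: point_spectrum_def inj_on_shifted_iff)
  have "E (far \<mu> n) x = 0" for n
    using inv_on_far_shift[OF x(1), of \<mu> n] x(2) bounded_clinear_0[OF \<Phi>_clinear[OF bdd_inv_on_far]]
    by simp
  then have "x - E (f -` {\<mu>}) x = 0"
    using far_tendsto[of \<mu> x] by (simp add: LIMSEQ_const_iff)
  then have "E (f -` {\<mu>}) x \<noteq> 0" using x(3) by (metis diff_zero)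
  then show "\<exists>x. E (f -` {\<mu>}) x \<noteq> 0" ..
next
  fix \<mu> x assume "E (f -` {\<mu>}) x \<noteq> 0"
  \<comment> \<open>The level set may be unbounded; cutting it down to a disc puts the vector into
    \<open>D\<close>.\<close>
  then obtain n where n: "E (cball 0 (real n) \<inter> f -` {\<mu>}) x \<noteq> 0" (is "E ?\<delta> x \<noteq> 0")
    using E_zero_if_bounded_zero[of "f -` {\<mu>}" x] level_borel[of "{\<mu>}"] by auto
  have \<delta>: "?\<delta> \<in> sets borel" "bounded ?\<delta>"
    using level_borel[of "{\<mu>}"] by (auto simp: bounded_Int)
  have "(\<lambda>z. (f z - \<mu>) * indicator ?\<delta> z) = (\<lambda>z. 0)" by (auto simp: indicator_def)
  then have "shifted B \<mu> (E ?\<delta> x) = 0" using shifted_E[OF \<delta>] \<Phi>_const[of 0 x] by simp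
  then show "\<mu> \<in> point_spectrum D B"
    using n E_domain[OF \<delta>] by (auto simp: point_spectrum_def inj_on_shifted_iff)
qed

lemma not_point_spectrumD: "\<mu> \<notin> point_spectrum D B \<Longrightarrow> (\<lambda>n. E (far \<mu> n) x) \<longlonglongrightarrow> x"
  using far_tendsto[of \<mu> x] by (simp add: point_spectrum_eq)

text \<open>Without eigenvectors the vectors \<open>E (far \<mu> n) x\<close> converge to
  \<open>x\<close>, and each has an explicit preimage under the shifted operator.\<close>

lemma dense_range:
  assumes "\<mu> \<notin> point_spectrum D B"
  shows "closure (shifted B \<mu> ` D) = UNIV"
proof -
  have "x \<in> closure (shifted B \<mu> ` D)" for x
    unfolding closure_sequential
    by (intro exI[of _ "\<lambda>n. E (far \<mu> n) x"] conjI allI E_far_in_range not_point_spectrumD assms)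
  then show ?thesis by auto
qed

theorem residual_spectrum_empty: "residual_spectrum D B = {}"
  using dense_range by (auto simp: residual_spectrum_def point_spectrum_def)

section \<open>Resolvent set and continuous spectrum\<close>

lemma near_borel: "{z. cmod (f z - \<mu>) < r} \<in> sets borel"
  by measurable

text \<open>The complement \<open>F\<close> carries all of \<open>E\<close>, and the integral
  \<open>R\<close> of \<open>1 / (f - \<mu>)\<close> over \<open>F\<close> is the inverse. The
  inverse identities hold within each disc; closedness of \<open>B\<close> puts \<open>R x\<close>
  into the domain when the discs grow.\<close>

lemma resolvent_set_if_null:
  assumes e: "e > 0" and null: "\<And>x. E {z. cmod (f z - \<mu>) < e} x = 0"
  shows "\<mu> \<in> resolvent_set D B"
proof -
  define F where "F = {z. cmod (f z - \<mu>) \<ge> e}"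
  have F: "F \<in> sets borel" using closed_far_set by (simp add: F_def)
  have Fe: "cmod (f z - \<mu>) \<ge> e" if "z \<in> F" for z using that by (simp add: F_def)
  have "F = - {z. cmod (f z - \<mu>) < e}" by (auto simp: F_def)
  then have EF: "E F x = x" for x using E_Compl[OF near_borel] null by simp
  define R where "R = \<Phi> (inv_on \<mu> F)"
  have R: "bounded_clinear R" unfolding R_def by (intro \<Phi>_clinear bdd_inv_on[OF F e Fe])
  let ?P = "\<lambda>n. cball (0::complex) (real n)"
  have P: "?P n \<in> sets borel" "bounded (?P n)" for n by auto
  have right: "R x \<in> D \<and> shifted B \<mu> (R x) = x" for x
  proof -
    let ?u = "\<lambda>n. E (?P n) (R x)"
    have u: "?u \<longlonglongrightarrow> R x" by (rule E_cball_tendsto)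
    have "shifted B \<mu> (?u n) = E (?P n) x" for n
      using E_shift_inv_on[OF F e Fe P, of n x] by (simp add: R_def E_Int F EF)
    then have "B (?u n) = E (?P n) x + \<mu> *\<^sub>C ?u n" for n
      by (simp add: shifted_def algebra_simps)
    moreover have "(\<lambda>n. E (?P n) x + \<mu> *\<^sub>C ?u n) \<longlonglongrightarrow> x + \<mu> *\<^sub>C R x"
      by (intro tendsto_add tendsto_scaleC E_cball_tendsto)
    ultimately have "(\<lambda>n. B (?u n)) \<longlonglongrightarrow> x + \<mu> *\<^sub>C R x" by simp
    with u have "(\<lambda>n. (?u n, B (?u n))) \<longlonglongrightarrow> (R x, x + \<mu> *\<^sub>C R x)" by (rule tendsto_Pair)
    moreover have "(?u n, B (?u n)) \<in> {(x, B x) |x. x \<in> D}" for n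
      using E_domain[OF P] by blast
    ultimately have "(R x, x + \<mu> *\<^sub>C R x) \<in> {(x, B x) |x. x \<in> D}"
      by (rule closed_sequentially[OF closed[unfolded closed_operator_def], rotated])
    then have "B (R x) = x + \<mu> *\<^sub>C R x" "R x \<in> D" by auto
    then show ?thesis by (simp add: shifted_def)
  qed
  have left: "R (shifted B \<mu> x) = x" if "x \<in> D" for x
  proof -
    have "(\<lambda>n. R (E (?P n) (shifted B \<mu> x))) \<longlonglongrightarrow> R (shifted B \<mu> x)"
      by (intro bounded_clinear_tendsto[OF R] E_cball_tendsto)
    moreover have "R (E (?P n) (shifted B \<mu> x)) = E (?P n) x" for n
      using inv_on_E_shift[OF F e Fe P that, of n] by (simp add: R_def E_Int F EF)
    ultimately show ?thesis using E_cball_tendsto[of x] LIMSEQ_unique by fastforce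
  qed
  have inj: "inj_on (shifted B \<mu>) D" using left by (rule inj_on_inverseI)
  have "inv_into D (shifted B \<mu>) = R"
    using right by (auto intro!: ext inv_into_f_eq[OF inj])
  moreover have "shifted B \<mu> ` D = UNIV" using right by (metis UNIV_eq_I image_eqI)
  ultimately show ?thesis using R inj by (simp add: resolvent_set_def bij_betw_def)
qed

text \<open>On the range of \<open>E\<close> over a bounded part of the set where \<open>f\<close>
  is within \<open>e\<close> of \<open>\<mu>\<close>, the shifted operator has norm at most
  \<open>4 * e * bound\<close>. For small \<open>e\<close> this contradicts the lower bound unless
  the range is trivial.\<close>

lemma null_if_bounded_below:
  assumes below: "\<And>x. x \<in> D \<Longrightarrow> norm x \<le> K * norm (shifted B \<mu> x)" and K: "K > 0"
  shows "\<exists>e>0. \<forall>x. E {z. cmod (f z - \<mu>) < e} x = 0"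
proof (intro exI conjI allI)
  \<comment> \<open>Chosen so that \<open>K * (4 * e * bound)\<close> equals one half.\<close>
  define e where "e = 1 / (8 * bound * K)"
  show "e > 0" using bound_pos K by (simp add: e_def)
  fix x
  show "E {z. cmod (f z - \<mu>) < e} x = 0"
  proof (rule E_zero_if_bounded_zero[OF near_borel])
    fix n
    let ?\<delta> = "cball 0 (real n) \<inter> {z. cmod (f z - \<mu>) < e}"
    have \<delta>: "?\<delta> \<in> sets borel" "bounded ?\<delta>" using near_borel[of \<mu> e] by (auto simp: bounded_Int)
    let ?y = "E ?\<delta> x"
    have "shifted B \<mu> ?y = \<Phi> (\<lambda>z. (f z - \<mu>) * indicator ?\<delta> z) ?y"
      using shifted_E[OF \<delta>, of \<mu> ?y] E_idem[OF \<delta>(1)] by simp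
    moreover have "norm (\<Phi> (\<lambda>z. (f z - \<mu>) * indicator ?\<delta> z) ?y) \<le> 4 * e * bound * norm ?y"
      using \<open>e > 0\<close> by (intro \<Phi>_bound bdd_f_indicator \<delta>) (auto simp: indicator_def)
    ultimately have "norm (shifted B \<mu> ?y) \<le> 4 * e * bound * norm ?y" by simp
    then have "K * norm (shifted B \<mu> ?y) \<le> K * (4 * e * bound * norm ?y)"
      using K by (intro mult_left_mono) auto
    then have "norm ?y \<le> K * (4 * e * bound * norm ?y)"
      using below[OF E_domain[OF \<delta>], of x] by (rule order_trans[rotated])
    also have "\<dots> = norm ?y / 2" using K bound_pos by (simp add: e_def)
    finally show "?y = 0" by simp
  qed
qed

theorem resolvent_set_eq: "resolvent_set D B = {\<mu>. \<exists>e>0. \<forall>x. E {z. cmod (f z - \<mu>) < e} x = 0}"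
proof safe
  fix \<mu> assume \<mu>: "\<mu> \<in> resolvent_set D B"
  let ?R = "inv_into D (shifted B \<mu>)"
  have bij: "bij_betw (shifted B \<mu>) D UNIV" and R: "bounded_linear ?R"
    using \<mu> by (auto simp: resolvent_set_def bounded_clinear_def)
  show "\<exists>e>0. \<forall>x. E {z. cmod (f z - \<mu>) < e} x = 0"
  proof (rule null_if_bounded_below)
    fix x assume "x \<in> D"
    then have "norm x = norm (?R (shifted B \<mu> x))" using bij by (simp add: bij_betw_def)
    also have "\<dots> \<le> onorm ?R * norm (shifted B \<mu> x)" using R by (rule onorm)
    also have "\<dots> \<le> (onorm ?R + 1) * norm (shifted B \<mu> x)" by (simp add: distrib_right)
    finally show "norm x \<le> (onorm ?R + 1) * norm (shifted B \<mu> x)" .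
  qed (use onorm_pos_le[OF R] in linarith)
qed (use resolvent_set_if_null in blast)

lemma point_spectrum_subset: "point_spectrum D B \<subseteq> spectrum D B"
  by (auto simp: point_spectrum_def spectrum_def resolvent_set_def bij_betw_def)

text \<open>Boundedness of the inverse has to be derived here. By surjectivity every
  \<open>x\<close> is the image of some \<open>y\<close>, so the partial inverses map it to
  \<open>E (far \<mu> n) y\<close>, bounded in \<open>n\<close>. Uniform boundedness followed by the
  limit in \<open>n\<close> yields a lower bound for the shifted operator.\<close>

lemma resolvent_set_if_bijective:
  assumes inj: "\<mu> \<notin> point_spectrum D B" and surj: "shifted B \<mu> ` D = UNIV"
  shows "\<mu> \<in> resolvent_set D B"
proof -
  let ?R = "\<lambda>n. \<Phi> (inv_on \<mu> (far \<mu> n))"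
  have R: "?R n (shifted B \<mu> y) = E (far \<mu> n) y" if "y \<in> D" for n y
    using that by (rule inv_on_far_shift)
  have lin: "bounded_linear (?R n)" for n
    using bounded_clinear_bounded_linear[OF \<Phi>_clinear[OF bdd_inv_on_far]] .
  have "\<exists>C. \<forall>n\<in>UNIV. norm (?R n x) \<le> C" for x
  proof -
    obtain y where "y \<in> D" "x = shifted B \<mu> y" using surj by blast
    then show ?thesis using R E_bound[OF far_borel] by metis
  qed
  then obtain K where K: "K \<ge> 0" "\<And>n x. norm (?R n x) \<le> K * norm x"
    using uniform_boundedness[of UNIV ?R] lin by blast
  have "norm y \<le> (K + 1) * norm (shifted B \<mu> y)" if "y \<in> D" for y
  proof -
    have "norm y \<le> K * norm (shifted B \<mu> y)"
    proof (rule LIMSEQ_le_const2)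
      show "(\<lambda>n. norm (E (far \<mu> n) y)) \<longlonglongrightarrow> norm y"
        by (intro tendsto_norm not_point_spectrumD inj)
      show "\<exists>N. \<forall>n\<ge>N. norm (E (far \<mu> n) y) \<le> K * norm (shifted B \<mu> y)"
        using K(2) R[OF that] by metis
    qed
    then show ?thesis by (simp add: distrib_right add_increasing2)
  qed
  then have "\<exists>e>0. \<forall>x. E {z. cmod (f z - \<mu>) < e} x = 0"
    using K(1) by (intro null_if_bounded_below[of "K + 1"]) auto
  then show ?thesis by (simp add: resolvent_set_eq)
qed

text \<open>Off the point spectrum the range is dense, and it can be the whole space only for
  \<open>\<mu>\<close> in the resolvent set.\<close>

theorem continuous_spectrum_eq: "continuous_spectrum D B = spectrum D B - point_spectrum D B"
proof safe
  fix \<mu> assume "\<mu> \<in> continuous_spectrum D B"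
  then show "\<mu> \<in> spectrum D B"
    by (auto simp: continuous_spectrum_def spectrum_def resolvent_set_def bij_betw_def)
next
  fix \<mu> assume "\<mu> \<in> continuous_spectrum D B" "\<mu> \<in> point_spectrum D B"
  then show False by (simp add: continuous_spectrum_def point_spectrum_def)
next
  fix \<mu> assume "\<mu> \<in> spectrum D B" and p: "\<mu> \<notin> point_spectrum D B"
  then have "shifted B \<mu> ` D \<noteq> UNIV"
    using resolvent_set_if_bijective by (auto simp: spectrum_def)
  then show "\<mu> \<in> continuous_spectrum D B"
    using p dense_range[OF p] by (simp add: continuous_spectrum_def point_spectrum_def)
qed

end

section \<open>The semigroup as a function of the spectral measure\<close>

lemma bounded_subset_cball_nat:
  fixes \<delta> :: "'a::real_normed_vector set"
  assumes "bounded \<delta>"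
  shows "\<exists>m. \<forall>n\<ge>m. \<delta> \<subseteq> cball 0 (real n)"
proof -
  obtain r where r: "\<forall>z\<in>\<delta>. norm z \<le> r" using assms by (auto simp: bounded_iff)
  obtain m where m: "r \<le> real m" using real_arch_simple by blast
  have "\<delta> \<subseteq> cball 0 (real n)" if "m \<le> n" for n
    using r m that by (fastforce intro: order_trans)
  then show ?thesis by blast
qed

section \<open>The generator as the identity function of the measure\<close>

context spectral_resolution
begin

lemma \<Phi>_E:
  assumes "bdd_borel g" "\<delta> \<in> sets borel"
  shows "\<Phi> g (E \<delta> x) = \<Phi> (\<lambda>z. g z * indicator \<delta> z) x"
  using assms by (simp add: \<Phi>_mult bdd_borel_indicator \<Phi>_indicator)

lemma E_\<Phi>:
  assumes "bdd_borel g" "\<delta> \<in> sets borel"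
  shows "E \<delta> (\<Phi> g x) = \<Phi> (\<lambda>z. g z * indicator \<delta> z) x"
  using \<Phi>_mult[OF bdd_borel_indicator[OF assms(2)] assms(1), of x] assms
  by (simp add: \<Phi>_indicator mult.commute)

text \<open>Once the disc of radius \<open>n\<close> contains the bounded set
  \<open>\<delta>\<close>, truncation no longer affects the integrand on \<open>\<delta>\<close>.
  The sequences that define \<open>A\<close> are therefore eventually constant after composition
  with \<open>E \<delta>\<close> on either side.\<close>

lemma spectral_function_identity:
  assumes E: "resolution_of_identity E D A" and "linear_operator D A" "closed_operator D A"
  shows "spectral_function E (\<lambda>z. z) D A"
proof unfold_locales
  let ?I = "\<lambda>n. \<Phi> (truncated_identity n)"
  have trunc: "truncated_identity n = (\<lambda>z. z * indicator (cball 0 (real n)) z)" for n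
    by (auto simp: truncated_identity_def indicator_def fun_eq_iff)
  have bdd: "bdd_borel (truncated_identity n)" for n
    unfolding trunc by (intro bdd_borel_mult_indicator continuous_on_id) auto
  have trunc_\<delta>: "\<exists>m. \<forall>n\<ge>m. (\<lambda>z. truncated_identity n z * indicator \<delta> z) = (\<lambda>z. z * indicator \<delta> z)"
    if \<delta>: "bounded \<delta>" for \<delta>
  proof -
    obtain m where m: "\<And>n. m \<le> n \<Longrightarrow> \<delta> \<subseteq> cball 0 (real n)"
      using bounded_subset_cball_nat[OF \<delta>] by blast
    have "(\<lambda>z. truncated_identity n z * indicator \<delta> z) = (\<lambda>z. z * indicator \<delta> z)" if "m \<le> n" for n
      using m[OF that] unfolding trunc by (force simp: indicator_def)
    then show ?thesis by blast
  qed
  have D: "D = {x. convergent (\<lambda>n. ?I n x)}" and A: "\<And>x. x \<in> D \<Longrightarrow> (\<lambda>n. ?I n x) \<longlonglongrightarrow> A x"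
    using E by (auto simp: resolution_of_identity_def)
  have lim: "(\<lambda>n. ?I n (E \<delta> x)) \<longlonglongrightarrow> \<Phi> (\<lambda>z. z * indicator \<delta> z) x"
    and lim': "(\<lambda>n. E \<delta> (?I n x)) \<longlonglongrightarrow> \<Phi> (\<lambda>z. z * indicator \<delta> z) x"
    if \<delta>: "\<delta> \<in> sets borel" "bounded \<delta>" for \<delta> x
  proof -
    obtain m where "\<And>n. n \<ge> m \<Longrightarrow> (\<lambda>z. truncated_identity n z * indicator \<delta> z) = (\<lambda>z. z * indicator \<delta> z)"
      using trunc_\<delta>[OF \<delta>(2)] by blast
    then have "?I n (E \<delta> x) = \<Phi> (\<lambda>z. z * indicator \<delta> z) x" "E \<delta> (?I n x) = \<Phi> (\<lambda>z. z * indicator \<delta> z) x"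
      if "n \<ge> m" for n
      using that by (simp_all add: \<Phi>_E[OF bdd \<delta>(1)] E_\<Phi>[OF bdd \<delta>(1)])
    then show "(\<lambda>n. ?I n (E \<delta> x)) \<longlonglongrightarrow> \<Phi> (\<lambda>z. z * indicator \<delta> z) x"
      "(\<lambda>n. E \<delta> (?I n x)) \<longlonglongrightarrow> \<Phi> (\<lambda>z. z * indicator \<delta> z) x"
      by (auto intro!: tendsto_eventually exI[of _ m] simp: eventually_sequentially)
  qed
  fix \<delta> :: "complex set" and x assume \<delta>: "\<delta> \<in> sets borel" "bounded \<delta>"
  show dom: "E \<delta> x \<in> D" using lim[OF \<delta>, of x] unfolding D convergent_def by blast
  show "A (E \<delta> x) = \<Phi> (\<lambda>z. z * indicator \<delta> z) x"
    using A[OF dom] lim[OF \<delta>, of x] by (rule LIMSEQ_unique)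
  show "E \<delta> (A x) = \<Phi> (\<lambda>z. z * indicator \<delta> z) x" if "x \<in> D"
    using bounded_clinear_tendsto[OF E_clinear[OF \<delta>(1)] A[OF that]] lim'[OF \<delta>, of x] by (rule LIMSEQ_unique)
qed (use assms in auto)

end

section \<open>Local boundedness of the semigroup\<close>

locale spectral_semigroup = spectral_function E "\<lambda>z. z" D A
  for E :: "complex set \<Rightarrow> 'a::complex_banach \<Rightarrow> 'a" and D A +
  fixes T :: "real \<Rightarrow> 'a \<Rightarrow> 'a"
  assumes semigroup: "C0_semigroup T" and generator: "generates D A T"
begin

lemma T_clinear: "t \<ge> 0 \<Longrightarrow> bounded_clinear (T t)"
  and T_0: "T 0 x = x"
  and T_add: "s \<ge> 0 \<Longrightarrow> t \<ge> 0 \<Longrightarrow> T (s + t) x = T s (T t x)"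
  and T_tendsto: "((\<lambda>t. T t x) \<longlongrightarrow> x) (at_right 0)"
  using semigroup by (auto simp: C0_semigroup_def)

text \<open>Otherwise there are times \<open>s n\<close> tending to zero at which the operator norm
  exceeds \<open>n\<close>. Strong continuity makes \<open>T (s n) x\<close> convergent for every
  \<open>x\<close>, contrary to uniform boundedness.\<close>

lemma T_bounded_near_0: "\<exists>\<eta>>0. \<exists>K. \<forall>s. 0 \<le> s \<and> s \<le> \<eta> \<longrightarrow> (\<forall>x. norm (T s x) \<le> K * norm x)"
proof (rule ccontr)
  assume *: "\<not> ?thesis"
  have "\<exists>s x. 0 \<le> s \<and> s \<le> 1 / real (Suc n) \<and> norm (T s x) > real n * norm x" for n
  proof -
    have "1 / real (Suc n) > 0" by simp
    with * show ?thesis by (meson not_le)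
  qed
  then obtain s where s: "\<And>n. 0 \<le> s n \<and> s n \<le> 1 / real (Suc n)"
    and big: "\<And>n. \<exists>x. norm (T (s n) x) > real n * norm x" by metis
  have lim: "(\<lambda>n. T (s n) x) \<longlonglongrightarrow> x" for x
  proof (rule metric_LIMSEQ_I)
    fix e :: real assume e: "e > 0"
    then have "\<forall>\<^sub>F t in at_right 0. dist (T t x) x < e" by (rule tendstoD[OF T_tendsto])
    then obtain d where d: "d > 0" "\<And>t. 0 < t \<Longrightarrow> t < d \<Longrightarrow> dist (T t x) x < e"
      by (auto simp: eventually_at_right_field)
    obtain N where N: "1 / real (Suc N) < d"
      using reals_Archimedean[OF d(1)] by (auto simp: inverse_eq_divide)
    \<comment> \<open>The right-hand limit says nothing about time zero itself, so
      \<open>s n = 0\<close> is a separate case.\<close>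
    have "dist (T (s n) x) x < e" if "n \<ge> N" for n
    proof (cases "s n = 0")
      case False
      have "1 / real (Suc n) \<le> 1 / real (Suc N)" using that by (intro divide_left_mono) auto
      then have "s n < d" using s[of n] N by linarith
      then show ?thesis using d(2)[of "s n"] s[of n] False by auto
    qed (simp add: T_0 e)
    then show "\<exists>N. \<forall>n\<ge>N. dist (T (s n) x) x < e" by blast
  qed
  have "\<exists>C. \<forall>n\<in>UNIV. norm (T (s n) x) \<le> C" for x
  proof -
    have "Bseq (\<lambda>n. T (s n) x)" using lim[of x] convergent_def convergent_imp_Bseq by blast
    then show ?thesis by (auto simp: Bseq_def)
  qed
  then have "\<exists>K\<ge>0. \<forall>n\<in>UNIV. \<forall>x. norm (T (s n) x) \<le> K * norm x"
    by (intro uniform_boundedness bounded_clinear_bounded_linear T_clinear) (use s in auto)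
  then obtain K where K: "\<And>n x. norm (T (s n) x) \<le> K * norm x" by blast
  obtain n where n: "K \<le> real n" using real_arch_simple by blast
  obtain x where "norm (T (s n) x) > real n * norm x" using big by blast
  moreover have "K * norm x \<le> real n * norm x" using n by (intro mult_right_mono) auto
  ultimately show False using K[of n x] by linarith
qed

text \<open>The time is covered by steps of length \<open>\<eta>\<close>, each costing one factor
  \<open>K\<close>. Taking \<open>K\<close> at least 1 lets shorter times share the bound.\<close>

lemma T_locally_bounded: "\<exists>K>0. \<forall>s. 0 \<le> s \<and> s \<le> t \<longrightarrow> (\<forall>x. norm (T s x) \<le> K * norm x)"
proof -
  obtain \<eta> K0 where \<eta>: "\<eta> > 0" and K0: "\<And>s x. 0 \<le> s \<Longrightarrow> s \<le> \<eta> \<Longrightarrow> norm (T s x) \<le> K0 * norm x"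
    using T_bounded_near_0 by blast
  define K where "K = max K0 1"
  have K: "norm (T s x) \<le> K * norm x" if "0 \<le> s" "s \<le> \<eta>" for s x
    using K0[OF that, of x] by (rule order_trans) (auto simp: K_def intro: mult_right_mono)
  have "K \<ge> 1" by (simp add: K_def)
  have "norm (T s x) \<le> K ^ Suc n * norm x" if "0 \<le> s" "s \<le> real (Suc n) * \<eta>" for n s x
    using that
  proof (induction n arbitrary: s x)
    case 0
    then show ?case using K by simp
  next
    case (Suc n)
    show ?case
    proof (cases "s \<le> \<eta>")
      case True
      have "norm (T s x) \<le> K ^ 1 * norm x" using K[OF Suc.prems(1) True] by simp
      also have "\<dots> \<le> K ^ Suc (Suc n) * norm x"
        by (intro mult_right_mono power_increasing) (use \<open>K \<ge> 1\<close> in auto)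
      finally show ?thesis .
    next
      case False
      have "T s x = T \<eta> (T (s - \<eta>) x)" using T_add[of \<eta> "s - \<eta>" x] \<eta> False by simp
      also have "norm \<dots> \<le> K * norm (T (s - \<eta>) x)" using \<eta> by (intro K) auto
      also have "\<dots> \<le> K * (K ^ Suc n * norm x)"
        using Suc False \<open>K \<ge> 1\<close> by (intro mult_left_mono Suc.IH) (auto simp: algebra_simps)
      finally show ?thesis by (simp add: mult.assoc)
    qed
  qed
  moreover obtain n where "t / \<eta> \<le> real (Suc n)"
    using real_arch_simple[of "t / \<eta>"] by (metis of_nat_Suc add_increasing zero_le_one)
  then have "t \<le> real (Suc n) * \<eta>" using \<eta> by (simp add: divide_simps)
  ultimately have "\<forall>s. 0 \<le> s \<and> s \<le> t \<longrightarrow> (\<forall>x. norm (T s x) \<le> K ^ Suc n * norm x)"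
    by (meson order_trans)
  moreover have "K ^ Suc n > 0" using \<open>K \<ge> 1\<close> by simp
  ultimately show ?thesis by blast
qed

section \<open>Comparison with the exponential group on the range of one disc\<close>

context
  fixes m :: nat
begin

abbreviation (input) "Q \<equiv> cball (0::complex) (real m)"

lemma Q: "Q \<in> sets borel" "bounded Q"
  by auto

text \<open>The group generated by the bounded part of \<open>A\<close> on the range of
  \<open>E Q\<close>, extended by zero on the complementary range; hence \<open>S 0\<close> is
  \<open>E Q\<close> and not the identity. Unlike \<open>T\<close>, it is used at negative times
  too.\<close>

definition S :: "real \<Rightarrow> 'a \<Rightarrow> 'a" where
  "S s = \<Phi> (\<lambda>z. exp (of_real s * z) * indicator Q z)"

lemma bdd_exp: "\<delta> \<in> sets borel \<Longrightarrow> bounded \<delta> \<Longrightarrow> bdd_borel (\<lambda>z. exp (of_real s * z) * indicator \<delta> z)"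
  by (intro bdd_borel_mult_indicator continuous_intros)

lemma S_clinear: "bounded_clinear (S s)"
  unfolding S_def by (intro \<Phi>_clinear bdd_exp Q)

lemma S_add: "S s (S r x) = S (s + r) x"
proof -
  have "(\<lambda>z. (exp (of_real s * z) * indicator Q z) * (exp (of_real r * z) * indicator Q z))
      = (\<lambda>z. exp (of_real (s + r) * z) * indicator Q z :: complex)"
    by (auto simp: indicator_def exp_add algebra_simps)
  then show ?thesis unfolding S_def by (simp add: \<Phi>_mult[symmetric] bdd_exp[OF Q])
qed

lemma S_0: "S 0 x = E Q x"
  unfolding S_def using \<Phi>_indicator[OF Q(1)] by simp

lemma E_S: "E Q (S s x) = S s x"
  using S_add[of 0 s x] by (simp add: S_0)

lemma E_A_E: "E Q (A (E Q x)) = A (E Q x)"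
proof -
  have i: "bdd_borel (\<lambda>z. z * indicator Q z)" using bdd_f_indicator[OF Q, of 0] by simp
  have "E Q (\<Phi> (\<lambda>z. z * indicator Q z) x) = \<Phi> (\<lambda>z. (z * indicator Q z) * indicator Q z) x"
    by (rule E_\<Phi>[OF i Q(1)])
  also have "(\<lambda>z. (z * indicator Q z) * indicator Q z) = (\<lambda>z. z * indicator Q z :: complex)"
    by (auto simp: indicator_def)
  finally show ?thesis by (simp add: B_E[OF Q])
qed

lemma S_bound: "\<bar>s\<bar> \<le> 1 \<Longrightarrow> norm (S s x) \<le> 4 * exp (real m) * bound * norm x"
  unfolding S_def
proof (intro \<Phi>_bound bdd_exp Q)
  fix z assume s: "\<bar>s\<bar> \<le> 1"
  show "cmod (exp (of_real s * z) * indicator Q z) \<le> exp (real m)"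
  proof (cases "z \<in> Q")
    case True
    have "s * Re z \<le> \<bar>s\<bar> * \<bar>Re z\<bar>" by (metis abs_ge_self abs_mult)
    also have "\<dots> \<le> 1 * real m"
      using s True abs_Re_le_cmod[of z] by (intro mult_mono) auto
    finally show ?thesis using True by simp
  qed simp
qed

text \<open>The second-order Taylor remainder of \<open>exp\<close> is uniform on the disc, and
  \<open>\<Phi>_bound\<close> turns it into an operator estimate.\<close>

lemma S_expansion:
  assumes "\<bar>h\<bar> \<le> 1" and v: "E Q v = v"
  shows "norm (S h v - v - h *\<^sub>R A v) \<le> 4 * (exp (real m) * (real m)\<^sup>2 * h\<^sup>2) * bound * norm v"
proof -
  let ?g = "\<lambda>z. exp (of_real h * z) * indicator Q z" and ?i = "\<lambda>z. z * indicator Q z :: complex"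
  \<comment> \<open>This is \<open>exp (h * z) - 1 - h * z\<close> on the disc and zero outside,
    written as a sum to which \<open>\<Phi>_add\<close> applies.\<close>
  let ?r = "\<lambda>z. ?g z + ((-1) * indicator Q z + of_real (- h) * ?i z)"
  have i: "bdd_borel ?i" using bdd_f_indicator[OF Q, of 0] by simp
  have j: "bdd_borel (indicator Q)" by (intro bdd_borel_indicator Q)
  note b = bdd_exp[OF Q] bdd_borel_mult[OF bdd_borel_const j] bdd_borel_mult[OF bdd_borel_const i]
  have neg: "(-1) *\<^sub>C x = - x" for x :: 'a
    using scaleC_diff_left[of 0 1 x] by simp
  have r: "\<Phi> ?r v = S h v + (- E Q v + (- h) *\<^sub>R A (E Q v))"
    using \<Phi>_mult[OF bdd_borel_const j, of "-1" v] \<Phi>_mult[OF bdd_borel_const i, of "of_real (- h)" v]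
    by (simp only: \<Phi>_add b bdd_borel_add \<Phi>_const \<Phi>_indicator[OF Q(1)] B_E[OF Q] S_def neg scaleC_of_real)
  have "norm (\<Phi> ?r v) \<le> 4 * (exp (real m) * (real m)\<^sup>2 * h\<^sup>2) * bound * norm v"
  proof (intro \<Phi>_bound bdd_borel_add b)
    fix z
    show "cmod (?r z) \<le> exp (real m) * (real m)\<^sup>2 * h\<^sup>2"
    proof (cases "z \<in> Q")
      case True
      let ?w = "of_real h * z"
      have w: "cmod ?w \<le> \<bar>h\<bar> * real m"
        using True by (auto simp: norm_mult intro: mult_left_mono)
      also have "\<dots> \<le> 1 * real m" by (intro mult_right_mono assms) auto
      finally have "cmod ?w \<le> real m" by simp
      then have "exp \<bar>Re ?w\<bar> \<le> exp (real m)" using abs_Re_le_cmod[of ?w] by simp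
      moreover have "(cmod ?w)\<^sup>2 \<le> (\<bar>h\<bar> * real m)\<^sup>2" using w by (intro power_mono) auto
      ultimately have "exp \<bar>Re ?w\<bar> * (cmod ?w)\<^sup>2 \<le> exp (real m) * (\<bar>h\<bar> * real m)\<^sup>2"
        by (intro mult_mono) auto
      moreover have "cmod (exp ?w - (1 + ?w)) \<le> exp \<bar>Re ?w\<bar> * (cmod ?w)\<^sup>2"
        using Taylor_exp[of ?w 1] by (simp add: numeral_2_eq_2)
      ultimately show ?thesis using True by (simp add: power_mult_distrib algebra_simps)
    qed simp
  qed
  then show ?thesis unfolding r v by (simp add: diff_diff_eq[symmetric] add_diff_eq)
qed

definition G :: "real \<Rightarrow> 'a \<Rightarrow> 'a" where
  "G h x = T h x - S h x"

lemma eventually_unit: "\<forall>\<^sub>F h in at_right (0::real). 0 < h \<and> h \<le> 1"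
  using eventually_at_right_less[of "0::real"] eventually_at_right_field[of _ "0::real"]
  by (auto simp: eventually_at_right_field intro!: exI[of _ 1])

text \<open>Both \<open>T\<close> and \<open>S\<close> have right derivative \<open>A v\<close> at
  zero, so their difference is of smaller order than \<open>h\<close>.\<close>

lemma G_tendsto:
  assumes v: "E Q v = v"
  shows "((\<lambda>h. G h v /\<^sub>R h) \<longlongrightarrow> 0) (at_right 0)"
proof -
  have "v \<in> D" using E_domain[OF Q, of v] v by simp
  then have T: "((\<lambda>h. (T h v - v) /\<^sub>R h) \<longlongrightarrow> A v) (at_right 0)"
    using generator by (simp add: generates_def)
  define C where "C = 4 * (exp (real m) * (real m)\<^sup>2) * bound * norm v"
  have "((\<lambda>h. (S h v - v - h *\<^sub>R A v) /\<^sub>R h) \<longlongrightarrow> 0) (at_right 0)"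
  proof (rule Lim_null_comparison)
    show "\<forall>\<^sub>F h in at_right 0. norm ((S h v - v - h *\<^sub>R A v) /\<^sub>R h) \<le> C * h"
      using eventually_unit
    proof eventually_elim
      case (elim h)
      then have "norm (S h v - v - h *\<^sub>R A v) \<le> C * h\<^sup>2"
        using S_expansion[OF _ v, of h] by (simp add: C_def algebra_simps)
      then show ?case using elim by (simp add: divide_simps power2_eq_square mult.assoc)
    qed
    show "((\<lambda>h. C * h) \<longlongrightarrow> 0) (at_right 0)" by (rule tendsto_eq_intros refl | simp)+
  qed
  from tendsto_diff[OF tendsto_diff[OF T this] tendsto_const[of "A v"]]
  have "((\<lambda>h. (T h v - v) /\<^sub>R h - (S h v - v - h *\<^sub>R A v) /\<^sub>R h - A v) \<longlongrightarrow> 0) (at_right 0)" by simp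
  then show ?thesis
  proof (rule Lim_transform_eventually)
    show "\<forall>\<^sub>F h in at_right 0. (T h v - v) /\<^sub>R h - (S h v - v - h *\<^sub>R A v) /\<^sub>R h - A v = G h v /\<^sub>R h"
      using eventually_unit
    proof eventually_elim
      case (elim h)
      then have "h *\<^sub>R A v /\<^sub>R h = A v" by simp
      then show ?case by (simp add: G_def scaleR_diff_right)
    qed
  qed
qed

lemma G_tendsto_0:
  assumes v: "E Q v = v"
  shows "((\<lambda>h. G h v) \<longlongrightarrow> 0) (at_right 0)"
proof -
  have "((\<lambda>h. h *\<^sub>R (G h v /\<^sub>R h)) \<longlongrightarrow> 0 *\<^sub>R 0) (at_right 0)"
    by (intro tendsto_scaleR G_tendsto v tendsto_ident_at)
  then have "((\<lambda>h. h *\<^sub>R (G h v /\<^sub>R h)) \<longlongrightarrow> 0) (at_right 0)" by simp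
  moreover have "\<forall>\<^sub>F h in at_right 0. h *\<^sub>R (G h v /\<^sub>R h) = G h v"
    using eventually_unit by eventually_elim simp
  ultimately show ?thesis by (rule Lim_transform_eventually)
qed

text \<open>The argument now moves with \<open>h\<close>. Expanding it as
  \<open>v - h *\<^sub>R A v\<close> plus a remainder of order \<open>h\<close> squared, the fixed
  vectors are covered by the preceding limits, and the remainder by a bound for \<open>G h\<close>
  uniform in \<open>h\<close>.\<close>

lemma G_shift_tendsto:
  assumes v: "E Q v = v"
  shows "((\<lambda>h. G h (S (- h) v) /\<^sub>R h) \<longlongrightarrow> 0) (at_right 0)"
proof -
  obtain K where K: "K > 0" "\<And>s x. 0 \<le> s \<Longrightarrow> s \<le> 1 \<Longrightarrow> norm (T s x) \<le> K * norm x"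
    using T_locally_bounded[of 1] by blast
  define K' where "K' = K + 4 * exp (real m) * bound"
  define C where "C = 4 * (exp (real m) * (real m)\<^sup>2) * bound * norm v"
  have "K' > 0" using K(1) bound_pos by (simp add: K'_def add_pos_pos)
  let ?r = "\<lambda>h. S (- h) v - v + h *\<^sub>R A v"
  have lin: "bounded_linear (G h)" if "0 \<le> h" for h
    unfolding G_def[abs_def] using that
    by (intro bounded_linear_sub bounded_clinear_bounded_linear T_clinear S_clinear)
  have rem: "((\<lambda>h. G h (?r h) /\<^sub>R h) \<longlongrightarrow> 0) (at_right 0)"
  proof (rule Lim_null_comparison)
    show "\<forall>\<^sub>F h in at_right 0. norm (G h (?r h) /\<^sub>R h) \<le> (K' * C) * h"
      using eventually_unit
    proof eventually_elim
      case (elim h)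
      have "norm (G h (?r h)) \<le> norm (T h (?r h)) + norm (S h (?r h))"
        unfolding G_def by (rule norm_triangle_ineq4)
      also have "\<dots> \<le> K * norm (?r h) + 4 * exp (real m) * bound * norm (?r h)"
        using elim by (intro add_mono K S_bound) auto
      also have "\<dots> = K' * norm (?r h)" by (simp add: K'_def distrib_right)
      also have "\<dots> \<le> K' * (C * h\<^sup>2)"
        using S_expansion[OF _ v, of "- h"] elim \<open>K' > 0\<close>
        by (intro mult_left_mono) (auto simp: C_def algebra_simps)
      finally show ?case using elim by (simp add: divide_simps power2_eq_square mult.assoc)
    qed
    show "((\<lambda>h. (K' * C) * h) \<longlongrightarrow> 0) (at_right 0)" by (rule tendsto_eq_intros refl | simp)+
  qed
  \<comment> \<open>Since \<open>A\<close> preserves the range of \<open>E Q\<close>, the limit for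
    \<open>G h\<close> also applies to the vector \<open>A v\<close>.\<close>
  have "E Q (A v) = A v" using E_A_E[of v] v by simp
  from tendsto_add[OF tendsto_diff[OF G_tendsto[OF v] G_tendsto_0[OF this]] rem]
  have "((\<lambda>h. G h v /\<^sub>R h - G h (A v) + G h (?r h) /\<^sub>R h) \<longlongrightarrow> 0) (at_right 0)" by simp
  then show ?thesis
  proof (rule Lim_transform_eventually)
    show "\<forall>\<^sub>F h in at_right 0. G h v /\<^sub>R h - G h (A v) + G h (?r h) /\<^sub>R h = G h (S (- h) v) /\<^sub>R h"
      using eventually_unit
    proof eventually_elim
      case (elim h)
      interpret bounded_linear "G h" using lin elim by simp
      have "G h (S (- h) v) = G h v - h *\<^sub>R G h (A v) + G h (?r h)"
        by (simp add: add diff scaleR)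
      then show ?case using elim by (simp add: scaleR_add_right scaleR_diff_right)
    qed
  qed
qed

text \<open>The function \<open>r \<mapsto> T r (S (- r) y)\<close> has derivative zero: for \<open>a < b\<close> its increment is
  \<open>T a (G (b - a) (S (- b) y))\<close>, which is small both for fixed \<open>b\<close> and for fixed \<open>a\<close>.\<close>

lemma T_S:
  assumes t: "t \<ge> 0" and y: "E Q y = y"
  shows "T t (S (- t) y) = y"
proof -
  let ?F = "\<lambda>r. T r (S (- r) y)"
  obtain K where K: "K > 0" "\<And>s x. 0 \<le> s \<Longrightarrow> s \<le> t \<Longrightarrow> norm (T s x) \<le> K * norm x"
    using T_locally_bounded[of t] by blast
  have incr: "norm (?F b - ?F a) \<le> K * norm (G (b - a) (S (- b) y))" if "0 \<le> a" "a \<le> b" "b \<le> t" for a b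
  proof -
    have "?F b = T a (T (b - a) (S (- b) y))"
      using T_add[of a "b - a"] that by simp
    moreover have "S (- a) y = S (b - a) (S (- b) y)" by (simp add: S_add)
    ultimately have "?F b - ?F a = T a (G (b - a) (S (- b) y))"
      using bounded_clinear_diff_eq[OF T_clinear[OF that(1)]] by (simp add: G_def)
    then show ?thesis using K(2)[of a] that by simp
  qed
  have "(?F has_derivative (\<lambda>h. 0)) (at r within {0..t})" if r: "r \<in> {0..t}" for r
    unfolding has_derivative_within_alt
  proof (intro conjI allI impI)
    fix e :: real assume "e > 0"
    then have "e / K > 0" using K(1) by simp
    have v: "E Q (S (- r) y) = S (- r) y" by (rule E_S)
    \<comment> \<open>\<open>d1\<close> handles points left of \<open>r\<close>, where the vector
      \<open>S (- r) y\<close> is fixed; \<open>d2\<close> handles points \<open>q\<close> right of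
      \<open>r\<close>, where the vector is \<open>S (- q) y\<close> and moves with
      \<open>q\<close>.\<close>
    obtain d1 where d1: "d1 > 0" "\<And>h. 0 < h \<Longrightarrow> h < d1 \<Longrightarrow> norm (G h (S (- r) y) /\<^sub>R h) < e / K"
      using tendstoD[OF G_tendsto[OF v] \<open>e / K > 0\<close>] by (auto simp: eventually_at_right_field)
    obtain d2 where d2: "d2 > 0" "\<And>h. 0 < h \<Longrightarrow> h < d2 \<Longrightarrow> norm (G h (S (- h) (S (- r) y)) /\<^sub>R h) < e / K"
      using tendstoD[OF G_shift_tendsto[OF v] \<open>e / K > 0\<close>] by (auto simp: eventually_at_right_field)
    show "\<exists>d>0. \<forall>q\<in>{0..t}. norm (q - r) < d \<longrightarrow> norm (?F q - ?F r - 0) \<le> e * norm (q - r)"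
    proof (intro exI[of _ "min d1 d2"] conjI ballI impI)
      fix q assume q: "q \<in> {0..t}" "norm (q - r) < min d1 d2"
      consider "q = r" | "q < r" | "q > r" by linarith
      then show "norm (?F q - ?F r - 0) \<le> e * norm (q - r)"
      proof cases
        case 2
        then have "norm (G (r - q) (S (- r) y) /\<^sub>R (r - q)) < e / K" using q by (intro d1) auto
        then have "K * norm (G (r - q) (S (- r) y)) \<le> e * (r - q)"
          using 2 K(1) by (simp add: divide_simps mult.commute)
        moreover have "norm (?F r - ?F q) \<le> K * norm (G (r - q) (S (- r) y))"
          using 2 q r by (intro incr) auto
        ultimately show ?thesis using 2 by (simp add: norm_minus_commute)
      next
        case 3
        have "S (- (q - r)) (S (- r) y) = S (- q) y" by (simp add: S_add)
        moreover have "norm (G (q - r) (S (- (q - r)) (S (- r) y)) /\<^sub>R (q - r)) < e / K"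
          using 3 q by (intro d2) auto
        ultimately have "K * norm (G (q - r) (S (- q) y)) \<le> e * (q - r)"
          using 3 K(1) by (simp add: divide_simps mult.commute)
        moreover have "norm (?F q - ?F r) \<le> K * norm (G (q - r) (S (- q) y))"
          using 3 q r by (intro incr) auto
        ultimately show ?thesis using 3 by simp
      qed simp
    qed (use d1 d2 in auto)
  qed simp
  then obtain c where "\<forall>r\<in>{0..t}. ?F r = c"
    using has_derivative_zero_constant[of "{0..t}" ?F] by auto
  then have "?F t = c" "?F 0 = c" using t by (metis atLeastAtMost_iff order_refl)+
  then have "?F t = ?F 0" by simp
  then show ?thesis using y by (simp add: T_0 S_0)
qed

text \<open>Taking \<open>y = S t x\<close> in the preceding identity, the group law turns
  \<open>S (- t) y\<close> into \<open>E Q x\<close>.\<close>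

lemma T_E_cball: "t \<ge> 0 \<Longrightarrow> T t (E Q x) = S t x"
  using T_S[of t "S t x"] by (simp add: E_S S_add S_0)

end

text \<open>A bounded set lies in some disc, where the comparison with \<open>S\<close> applies. For
  the second identity \<open>x\<close> is approximated by its components in growing discs; the
  resulting sequence is eventually constant.\<close>

lemma T_E:
  assumes t: "t \<ge> 0" and \<delta>: "\<delta> \<in> sets borel" "bounded \<delta>"
  shows "T t (E \<delta> x) = \<Phi> (\<lambda>z. exp (of_real t * z) * indicator \<delta> z) x"
    and "E \<delta> (T t x) = \<Phi> (\<lambda>z. exp (of_real t * z) * indicator \<delta> z) x"
proof -
  let ?Q = "\<lambda>m. cball (0::complex) (real m)" and ?e = "\<lambda>z. exp (of_real t * z)"
  obtain m where "\<And>n. m \<le> n \<Longrightarrow> \<delta> \<subseteq> ?Q n"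
    using bounded_subset_cball_nat[OF \<delta>(2)] by blast
  then have m: "z \<in> ?Q n" if "z \<in> \<delta>" "m \<le> n" for z n
    using that by blast
  have eq: "(\<lambda>z. (?e z * indicator (?Q n) z) * indicator \<delta> z) = (\<lambda>z. ?e z * indicator \<delta> z)" if "m \<le> n" for n
    using m[OF _ that] by (auto simp: indicator_def fun_eq_iff)
  have b: "bdd_borel (\<lambda>z. ?e z * indicator (?Q n) z)" for n
    by (intro bdd_exp) auto
  have "?Q m \<inter> \<delta> = \<delta>" using m by auto
  then have "E (?Q m) (E \<delta> x) = E \<delta> x" using E_Int[of "?Q m" \<delta> x] \<delta> by simp
  then have "T t (E \<delta> x) = S m t (E \<delta> x)" using T_E_cball[OF t, of m "E \<delta> x"] by simp
  then show "T t (E \<delta> x) = \<Phi> (\<lambda>z. ?e z * indicator \<delta> z) x"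
    by (simp add: S_def \<Phi>_E[OF b \<delta>(1)] eq)
  have "(\<lambda>n. E \<delta> (T t (E (?Q n) x))) \<longlonglongrightarrow> E \<delta> (T t x)"
    using E_cball_tendsto[of x]
    by (rule bounded_clinear_tendsto[OF E_clinear[OF \<delta>(1)] bounded_clinear_tendsto[OF T_clinear[OF t]]])
  moreover have "(\<lambda>n. E \<delta> (T t (E (?Q n) x))) \<longlonglongrightarrow> \<Phi> (\<lambda>z. ?e z * indicator \<delta> z) x"
    by (rule tendsto_eventually)
       (auto simp: eventually_sequentially T_E_cball[OF t] S_def E_\<Phi>[OF b \<delta>(1)] eq intro!: exI[of _ m])
  ultimately show "E \<delta> (T t x) = \<Phi> (\<lambda>z. ?e z * indicator \<delta> z) x" by (rule LIMSEQ_unique)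
qed

lemma spectral_function_T:
  assumes t: "t \<ge> 0"
  shows "spectral_function E (\<lambda>z. exp (of_real t * z)) UNIV (T t)"
proof unfold_locales
  show "linear_operator UNIV (T t)"
    using T_clinear[OF t] by (simp add: linear_operator_def bounded_clinear_add_eq bounded_clinear_scaleC_eq)
  have "continuous_on UNIV (T t)"
    using T_clinear[OF t] by (intro linear_continuous_on bounded_clinear_bounded_linear)
  then have "continuous_on UNIV (\<lambda>p :: 'a \<times> 'a. T t (fst p))"
    by (rule continuous_on_compose2[OF _ continuous_on_fst[OF continuous_on_id]]) simp
  then have "closed {p. snd p = T t (fst p)}"
    by (rule closed_Collect_eq[OF continuous_on_snd[OF continuous_on_id]])
  moreover have "{p. snd p = T t (fst p)} = {(x, T t x) |x. x \<in> UNIV}" by auto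
  ultimately show "closed_operator UNIV (T t)" by (simp add: closed_operator_def)
qed (auto intro: continuous_intros simp: T_E[OF t])

end

section \<open>Spectra of the generator and of the semigroup\<close>

lemma (in spectral_resolution) E_Union_zero:
  assumes "countable \<F>" "\<And>S. S \<in> \<F> \<Longrightarrow> S \<in> sets borel" "\<And>S. S \<in> \<F> \<Longrightarrow> E S x = 0"
  shows "E (\<Union>\<F>) x = 0"
proof (cases "\<F> = {}")
  case False
  then have "E (\<Union>n. from_nat_into \<F> n) x = 0"
    using assms by (intro E_countable_zero) (auto intro: from_nat_into)
  then show ?thesis using assms(1) False by (simp add: range_from_nat_into)
qed simp

text \<open>Two solutions differ by an integer multiple of the period of the exponential divided by
  \<open>c\<close>.\<close>

lemma countable_exp_level:
  assumes "c \<noteq> 0"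
  shows "countable {z. exp (c * z) = (\<mu>::complex)}"
proof (cases "\<exists>w. exp (c * w) = \<mu>")
  case True
  then obtain w where w: "exp (c * w) = \<mu>" ..
  have "{z. exp (c * z) = \<mu>} \<subseteq> range (\<lambda>n::int. (c * w + of_int (2 * n) * pi * \<i>) / c)"
  proof
    fix z assume "z \<in> {z. exp (c * z) = \<mu>}"
    then have "exp (c * z) = exp (c * w)" using w by simp
    then obtain n :: int where "c * z = c * w + of_int (2 * n) * pi * \<i>"
      unfolding exp_eq by blast
    then have "z = (c * w + of_int (2 * n) * pi * \<i>) / c"
      using assms by (simp add: nonzero_eq_divide_eq mult.commute)
    then show "z \<in> range (\<lambda>n::int. (c * w + of_int (2 * n) * pi * \<i>) / c)" by blast
  qed
  then show ?thesis by (rule countable_subset) simp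
qed simp

section \<open>Transfer of spectra from the generator to the semigroup\<close>

context spectral_semigroup
begin

lemma point_spectrum_A: "point_spectrum D A = {\<mu>. \<exists>x. E {\<mu>} x \<noteq> 0}"
  by (simp add: point_spectrum_eq vimage_def)

text \<open>The right-hand side is the support of \<open>E\<close>; it is the general description of
  the resolvent set for the identity function.\<close>

lemma spectrum_A: "spectrum D A = {\<mu>. \<forall>e>0. \<exists>x. E (ball \<mu> e) x \<noteq> 0}"
proof -
  have "{z. cmod (z - \<mu>) < e} = ball \<mu> e" for \<mu> e
    by (auto simp: dist_norm norm_minus_commute)
  then show ?thesis unfolding spectrum_def resolvent_set_eq by auto
qed

lemma closed_spectrum_A: "closed (spectrum D A)"
proof -
  have "\<exists>e>0. ball \<mu> e \<subseteq> - spectrum D A" if \<mu>: "\<mu> \<in> - spectrum D A" for \<mu>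
  proof -
    obtain e where e: "e > 0" "\<And>x. E (ball \<mu> e) x = 0" using \<mu> by (auto simp: spectrum_A)
    have "\<nu> \<in> - spectrum D A" if \<nu>: "\<nu> \<in> ball \<mu> e" for \<nu>
    proof -
      obtain d where d: "d > 0" "ball \<nu> d \<subseteq> ball \<mu> e" using openE[OF open_ball \<nu>] by blast
      then have "E (ball \<nu> d) x = 0" for x using e(2) by (intro E_subset_zero[OF _ _ d(2)]) auto
      then show ?thesis using d(1) by (auto simp: spectrum_A)
    qed
    then show ?thesis using e(1) by blast
  qed
  then have "open (- spectrum D A)" by (simp add: open_contains_ball)
  then show ?thesis by (simp add: closed_def)
qed

text \<open>Every point of the resolvent set has a null ball around it, but \<open>E\<close> is only
  countably additive; the Lindelof property reduces the cover to countably many balls.\<close>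

lemma E_resolvent_set: "E (- spectrum D A) x = 0"
proof -
  define \<F> where "\<F> = {ball \<mu> e | \<mu> e. \<forall>x. E (ball \<mu> e) x = 0}"
  obtain \<F>' where \<F>': "\<F>' \<subseteq> \<F>" "countable \<F>'" "\<Union>\<F>' = \<Union>\<F>"
    using Lindelof[of \<F>] by (auto simp: \<F>_def)
  have "E (\<Union>\<F>') x = 0"
    using \<F>' by (intro E_Union_zero) (auto simp: \<F>_def)
  moreover have "- spectrum D A \<subseteq> \<Union>\<F>'"
    unfolding \<F>'(3)
  proof
    fix \<mu> assume "\<mu> \<in> - spectrum D A"
    then obtain e where "e > 0" "\<forall>x. E (ball \<mu> e) x = 0" by (auto simp: spectrum_A)
    then show "\<mu> \<in> \<Union>\<F>" unfolding \<F>_def by (intro UnionI[of "ball \<mu> e"]) auto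
  qed
  moreover have "\<Union>\<F>' \<in> sets borel" using \<F>' by (intro sets.countable_Union) (auto simp: \<F>_def)
  moreover have "- spectrum D A \<in> sets borel" using closed_spectrum_A by auto
  ultimately show ?thesis using E_subset_zero by blast
qed

text \<open>The preimage of a disc around \<open>\<mu>\<close> under the exponential map is open. An
  open set is null for \<open>E\<close> exactly if it misses the support, which is the spectrum of
  \<open>A\<close>; here this means that the disc misses the image of the spectrum.\<close>

lemma spectrum_T:
  assumes t: "t \<ge> 0"
  shows "spectrum UNIV (T t) = closure (exp_image t (spectrum D A))"
proof -
  interpret T: spectral_function E "\<lambda>z. exp (of_real t * z)" UNIV "T t"
    by (rule spectral_function_T[OF t])
  let ?N = "\<lambda>\<mu> e. {z. cmod (exp (of_real t * z) - \<mu>) < e}"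
  have "\<mu> \<in> resolvent_set UNIV (T t) \<longleftrightarrow> \<mu> \<notin> closure (exp_image t (spectrum D A))" for \<mu>
  proof
    assume "\<mu> \<in> resolvent_set UNIV (T t)"
    then obtain e where e: "e > 0" "\<And>x. E (?N \<mu> e) x = 0" by (auto simp: T.resolvent_set_eq)
    have op: "open (?N \<mu> e)" by (intro open_Collect_less continuous_intros)
    have "\<not> dist (exp (of_real t * \<nu>)) \<mu> < e" if \<nu>: "\<nu> \<in> spectrum D A" for \<nu>
    proof
      assume "dist (exp (of_real t * \<nu>)) \<mu> < e"
      then have "\<nu> \<in> ?N \<mu> e" by (simp add: dist_norm)
      then obtain d where d: "d > 0" "ball \<nu> d \<subseteq> ?N \<mu> e" using op openE by blast
      then have "E (ball \<nu> d) x = 0" for x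
        using e(2) op by (intro E_subset_zero[OF _ _ d(2)]) auto
      then show False using \<nu> d(1) by (auto simp: spectrum_A)
    qed
    then show "\<mu> \<notin> closure (exp_image t (spectrum D A))"
      using e(1) by (auto simp: closure_approachable exp_image_def)
  next
    assume "\<mu> \<notin> closure (exp_image t (spectrum D A))"
    then obtain e where e: "e > 0" "\<And>\<nu>. \<nu> \<in> spectrum D A \<Longrightarrow> \<not> dist (exp (of_real t * \<nu>)) \<mu> < e"
      by (auto simp: closure_approachable exp_image_def)
    have "?N \<mu> e \<subseteq> - spectrum D A" using e(2) by (auto simp: dist_norm)
    moreover have "- spectrum D A \<in> sets borel" using closed_spectrum_A by auto
    ultimately have "E (?N \<mu> e) x = 0" for x
      using T.near_borel E_resolvent_set E_subset_zero by blast
    then show "\<mu> \<in> resolvent_set UNIV (T t)" using e(1) by (auto simp: T.resolvent_set_eq)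
  qed
  then show ?thesis by (auto simp: spectrum_def)
qed

text \<open>At time zero the operator is the identity, and on a nonzero space its only eigenvalue is
  1. The image contains 1 only if \<open>A\<close> has an eigenvalue, which is what
  \<open>nonempty\<close> provides.\<close>

lemma point_spectrum_T:
  assumes t: "t \<ge> 0" and nonempty: "t = 0 \<Longrightarrow> point_spectrum D A \<noteq> {}"
  shows "point_spectrum UNIV (T t) = exp_image t (point_spectrum D A)"
proof -
  interpret T: spectral_function E "\<lambda>z. exp (of_real t * z)" UNIV "T t"
    by (rule spectral_function_T[OF t])
  let ?L = "\<lambda>\<mu>::complex. {z. exp (of_real t * z) = \<mu>}"
  have L: "?L \<mu> \<in> sets borel" for \<mu> using T.level_borel[of "{\<mu>}"] by (simp add: vimage_def)
  have iff: "\<mu> \<in> point_spectrum UNIV (T t) \<longleftrightarrow> (\<exists>x. E (?L \<mu>) x \<noteq> 0)" for \<mu>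
    by (simp add: T.point_spectrum_eq vimage_def)
  show ?thesis
  proof (intro equalityI subsetI)
    fix \<mu> assume "\<mu> \<in> point_spectrum UNIV (T t)"
    then obtain x where x: "E (?L \<mu>) x \<noteq> 0" using iff by blast
    show "\<mu> \<in> exp_image t (point_spectrum D A)"
    proof (cases "t = 0")
      case True
      have "\<mu> = 1"
      proof (rule ccontr)
        assume "\<mu> \<noteq> 1"
        then have "?L \<mu> = {}" using True by auto
        then show False using x by simp
      qed
      then show ?thesis using True nonempty by (auto simp: exp_image_def)
    next
      case False
      \<comment> \<open>For positive \<open>t\<close> the level set is a countable union of its
        points, so \<open>E\<close> applied to \<open>x\<close> cannot vanish at all of
        them.\<close>
      have "\<exists>S\<in>(\<lambda>z. {z}) ` ?L \<mu>. E S x \<noteq> 0"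
      proof (rule ccontr)
        assume "\<not> ?thesis"
        then have "E (\<Union>((\<lambda>z. {z}) ` ?L \<mu>)) x = 0"
          using countable_exp_level[of "of_real t" \<mu>] False by (intro E_Union_zero) auto
        then show False using x by simp
      qed
      then show ?thesis by (auto simp: exp_image_def point_spectrum_A)
    qed
  next
    fix \<mu> assume "\<mu> \<in> exp_image t (point_spectrum D A)"
    then obtain \<nu> x where \<nu>: "\<mu> = exp (of_real t * \<nu>)" "E {\<nu>} x \<noteq> 0"
      by (auto simp: exp_image_def point_spectrum_A)
    then have "E (?L \<mu>) x \<noteq> 0" using E_subset_zero[of "{\<nu>}" "?L \<mu>" x] L by auto
    then show "\<mu> \<in> point_spectrum UNIV (T t)" using iff by blast
  qed
qed

text \<open>Every point of the spectrum is an approximate eigenvalue: nonzero vectors in the range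
  of \<open>E\<close> on a small ball are almost eigenvectors, which bounds
  \<open>cmod \<mu>\<close> by \<open>K\<close> up to an arbitrary error.\<close>

lemma bounded_spectrum_A:
  assumes "bounded_operator D A"
  shows "bounded (spectrum D A)"
proof -
  obtain K where K: "\<And>x. x \<in> D \<Longrightarrow> norm (A x) \<le> K * norm x"
    using assms by (auto simp: bounded_operator_def)
  have "cmod \<mu> \<le> K" if \<mu>: "\<mu> \<in> spectrum D A" for \<mu>
  proof (rule field_le_epsilon)
    fix e :: real assume "e > 0"
    \<comment> \<open>Chosen so that \<open>\<Phi>_bound\<close> gives exactly the error
      \<open>e\<close>.\<close>
    define d where "d = e / (4 * bound)"
    have d: "d > 0" "4 * d * bound = e" using \<open>e > 0\<close> bound_pos by (simp_all add: d_def)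
    obtain x where x: "E (ball \<mu> d) x \<noteq> 0" using \<mu> d(1) by (auto simp: spectrum_A)
    let ?y = "E (ball \<mu> d) x"
    have b: "ball \<mu> d \<in> sets borel" "bounded (ball \<mu> d)" by auto
    have "shifted A \<mu> ?y = \<Phi> (\<lambda>z. (z - \<mu>) * indicator (ball \<mu> d) z) ?y"
      using shifted_E[OF b, of \<mu> ?y] E_idem[OF b(1)] by simp
    moreover have "norm (\<Phi> (\<lambda>z. (z - \<mu>) * indicator (ball \<mu> d) z) ?y) \<le> 4 * d * bound * norm ?y"
      using d(1) by (intro \<Phi>_bound bdd_f_indicator b) (auto simp: indicator_def dist_norm norm_minus_commute)
    ultimately have "norm (A ?y - \<mu> *\<^sub>C ?y) \<le> e * norm ?y" using d(2) by (simp add: shifted_def)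
    moreover have "norm (\<mu> *\<^sub>C ?y) \<le> norm (A ?y) + norm (A ?y - \<mu> *\<^sub>C ?y)"
      using norm_triangle_ineq4[of "A ?y" "A ?y - \<mu> *\<^sub>C ?y"] by simp
    ultimately have "cmod \<mu> * norm ?y \<le> (K + e) * norm ?y"
      using K[OF E_domain[OF b, of x]] by (simp add: norm_scaleC distrib_right)
    then show "cmod \<mu> \<le> K + e" using x by simp
  qed
  then show ?thesis by (auto simp: bounded_iff)
qed

end

theorem theorem5p2:
  fixes T :: "real \<Rightarrow> 'a::complex_banach \<Rightarrow> 'a"
    and D :: "'a set" and A :: "'a \<Rightarrow> 'a"
  assumes "C0_semigroup T"
    and "generates D A T"
    and "scalar_type_spectral D A"
  shows
    "(\<forall>t\<ge>0. (t = 0 \<longrightarrow> point_spectrum D A \<noteq> {}) \<longrightarrow>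
        point_spectrum UNIV (T t) = exp_image t (point_spectrum D A)) \<and>
     (\<forall>t\<ge>0. residual_spectrum UNIV (T t) = {}) \<and>
     (\<forall>t\<ge>0. (t = 0 \<longrightarrow> point_spectrum D A \<noteq> {}) \<longrightarrow>
        continuous_spectrum UNIV (T t) =
          closure (exp_image t (spectrum D A)) - exp_image t (point_spectrum D A)) \<and>
     (\<forall>t>0. inj_on (\<lambda>z. exp (of_real t * z)) (spectrum D A) \<longrightarrow>
        continuous_spectrum UNIV (T t) =
          exp_image t (continuous_spectrum D A) \<union>
            (closure (exp_image t (spectrum D A)) - exp_image t (spectrum D A)) \<and>
        (closed (exp_image t (spectrum D A)) \<longrightarrow>
          continuous_spectrum UNIV (T t) = exp_image t (continuous_spectrum D A))) \<and>
     (bounded_operator D A \<longrightarrow> (\<forall>t>0. closed (exp_image t (spectrum D A))))"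
proof -
  obtain E where E: "resolution_of_identity E D A" and A: "linear_operator D A" "closed_operator D A"
    using assms(3) by (auto simp: scalar_type_spectral_def)
  interpret spectral_resolution E
    using E by unfold_locales (simp add: resolution_of_identity_def)
  interpret spectral_function E "\<lambda>z. z" D A
    using E A by (rule spectral_function_identity)
  interpret spectral_semigroup E D A T
    using assms by unfold_locales
  have residual: "residual_spectrum UNIV (T t) = {}" if "t \<ge> 0" for t
    by (rule spectral_function.residual_spectrum_empty[OF spectral_function_T[OF that]])
  have continuous: "continuous_spectrum UNIV (T t) =
      closure (exp_image t (spectrum D A)) - exp_image t (point_spectrum D A)"
    if t: "t \<ge> 0" "t = 0 \<Longrightarrow> point_spectrum D A \<noteq> {}" for t
    using spectral_function.continuous_spectrum_eq[OF spectral_function_T[OF t(1)]]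
    by (simp add: spectrum_T point_spectrum_T t)
  have injective: "continuous_spectrum UNIV (T t) = exp_image t (continuous_spectrum D A) \<union>
      (closure (exp_image t (spectrum D A)) - exp_image t (spectrum D A))"
    if t: "t > 0" and inj: "inj_on (\<lambda>z. exp (of_real t * z)) (spectrum D A)" for t
  proof -
    \<comment> \<open>Injectivity is what lets the image commute with removing the point spectrum;
      the rest is set algebra with the formula in \<open>continuous\<close>.\<close>
    have "exp_image t (continuous_spectrum D A) = exp_image t (spectrum D A) - exp_image t (point_spectrum D A)"
      unfolding exp_image_def continuous_spectrum_eq
      using point_spectrum_subset by (intro inj_on_image_set_diff[OF inj]) auto
    moreover have "exp_image t (point_spectrum D A) \<subseteq> exp_image t (spectrum D A)"
      unfolding exp_image_def by (intro image_mono point_spectrum_subset)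
    moreover have "exp_image t (spectrum D A) \<subseteq> closure (exp_image t (spectrum D A))"
      by (rule closure_subset)
    ultimately show ?thesis using continuous[of t] t by auto
  qed
  have bounded: "closed (exp_image t (spectrum D A))" if "bounded_operator D A" for t
  proof -
    \<comment> \<open>The spectrum of \<open>A\<close> is closed in any case; boundedness makes it
      compact, and so is its continuous image.\<close>
    have "compact (spectrum D A)"
      using closed_spectrum_A bounded_spectrum_A[OF that] by (simp add: compact_eq_bounded_closed)
    then show ?thesis
      unfolding exp_image_def
      by (intro compact_imp_closed compact_continuous_image continuous_intros)
  qed
  show ?thesis
  proof (intro conjI allI impI)
    fix t :: real
    assume t: "t > 0" "inj_on (\<lambda>z. exp (of_real t * z)) (spectrum D A)"
      and "closed (exp_image t (spectrum D A))"
    then show "continuous_spectrum UNIV (T t) = exp_image t (continuous_spectrum D A)"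
      using injective[OF t] by simp
  qed (use residual continuous injective bounded point_spectrum_T in auto)
qed

end
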